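(* Consider the projective action of $\mathrm{PGL}(2,\mathbb H)$ on $\mathbb P(\Lambda^2\mathbb C^4)\cong\mathbb{CP}^5$. Every $\mathrm{PGL}(2,\mathbb H)$-orbit in $\mathbb P(\Lambda^2\mathbb C^4)$ is the orbit of exactly one point of the following list: (A1) (real null) $p_N=[0:0:0:0:0:1]$; (A2) (non-real isotropic) $p_{Q\smallsetminus N}=[-1:0:-i:i:0:1]$; (B1) (real time-like) $p_+=[1:0:0:0:0:1]$; (B2) (real space-like) $p_-=[1:0:0:0:0:-1]$; (B3) (non-real degenerate) $p_{\mathrm{deg}}=[0:0:-i:i:0:1]$; (B4) (non-real Lorentzian) $p_\theta=[e^{i\theta}:0:0:0:0:1]$, with $0<\theta<\pi$; (B5) (non-real negative-definite) $p_\lambda=[1:0:-i\lambda:i\lambda:0:-1]$, with $0<\lambda<1$. In particular, distinct list entries (including distinct values of $\theta$, respectively of $\lambda$) give distinct orbits.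
   Context: Let $(e_1,e_2,e_3,e_4)$ be the standard basis of $\mathbb C^4$. Homogeneous coordinates $[\zeta_1:\dots:\zeta_6]$ on $\mathbb P(\Lambda^2\mathbb C^4)\cong\mathbb{CP}^5$ are taken with respect to the basis $E_1=e_3\wedge e_4$, $E_2=-e_2\wedge e_4$, $E_3=e_2\wedge e_3$, $E_4=e_1\wedge e_4$, $E_5=-e_1\wedge e_3$, $E_6=e_1\wedge e_2$. Let $\rho(\mathbb H):=\left\{\begin{pmatrix} z&-\overline w\\ w&\overline z\end{pmatrix}: z,w\in\mathbb C\right\}\subset \mathrm{Mat}_{2\times2}(\mathbb C)$. The group $\mathrm{GL}(2,\mathbb H)$ is realized as the subgroup of $\mathrm{GL}(4,\mathbb C)$ consisting of the invertible block matrices $\begin{pmatrix}A&B\\C&D\end{pmatrix}$ with $A,B,C,D\in\rho(\mathbb H)$, and $\mathrm{PGL}(2,\mathbb H):=\mathrm{GL}(2,\mathbb H)/\mathbb R^\times$, where $\mathbb R^\times$ denotes the nonzero real multiples of the identity. It acts on $\mathbb P(\Lambda^2\mathbb C^4)$ through the action of $\mathrm{GL}(4,\mathbb C)$ induced by $T\cdot(u\wedge v)=Tu\wedge Tv$. *)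

theory Defs
  imports "HOL-Analysis.Analysis" "HOL-Algebra.Group_Action"
begin

section \<open>The exterior square of complex 4-space\<close>

text \<open>The exterior square is modelled by the skew-symmetric complex 4 by 4 matrices, with
  \<open>u \<and> v = u v\<^sup>T - v u\<^sup>T\<close>.  Lemmas \<open>ext2_coordinates\<close> (the six basis wedges form a basis) and
  \<open>ext2_act_wedge\<close> (the action on decomposables) below confirm that this is the exterior square
  with the induced action of \<open>GL(4,\<complex>)\<close>.\<close>

definition ext2 :: "(complex^4^4) set" where
  "ext2 = {M. transpose M = - M}"

definition wedge :: "complex^4 \<Rightarrow> complex^4 \<Rightarrow> complex^4^4" where
  "wedge u v = (\<chi> i j. u $ i * v $ j - v $ i * u $ j)"

definition cscale :: "complex \<Rightarrow> complex^4^4 \<Rightarrow> complex^4^4" where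
  "cscale c M = (\<chi> i j. c * M $ i $ j)"

definition ext2_act :: "complex^4^4 \<Rightarrow> complex^4^4 \<Rightarrow> complex^4^4" where
  "ext2_act T M = T ** M ** transpose T"

abbreviation std :: "4 \<Rightarrow> complex^4" where
  "std i \<equiv> axis i 1"

definition coord_vec ::
  "complex \<Rightarrow> complex \<Rightarrow> complex \<Rightarrow> complex \<Rightarrow> complex \<Rightarrow> complex \<Rightarrow> complex^4^4" where
  "coord_vec z1 z2 z3 z4 z5 z6 =
     cscale z1 (wedge (std 3) (std 4)) + cscale z2 (- wedge (std 2) (std 4)) +
     cscale z3 (wedge (std 2) (std 3)) + cscale z4 (wedge (std 1) (std 4)) +
     cscale z5 (- wedge (std 1) (std 3)) + cscale z6 (wedge (std 1) (std 2))"

lemma wedge_in_ext2: "wedge u v \<in> ext2"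
  by (simp add: ext2_def wedge_def transpose_def vec_eq_iff)

lemma wedge_alternating: "wedge u u = 0"
  by (simp add: wedge_def vec_eq_iff)

lemma wedge_skew: "wedge u v = - wedge v u"
  by (simp add: wedge_def vec_eq_iff)

lemma wedge_add_left: "wedge (u + u') v = wedge u v + wedge u' v"
  by (simp add: wedge_def vec_eq_iff algebra_simps)

lemma wedge_scale_left: "wedge (c *s u) v = cscale c (wedge u v)"
  by (simp add: wedge_def cscale_def vec_eq_iff algebra_simps)

lemma coord_vec_nth:
  "coord_vec z1 z2 z3 z4 z5 z6 $ 1 $ 2 = z6" "coord_vec z1 z2 z3 z4 z5 z6 $ 1 $ 3 = - z5"
  "coord_vec z1 z2 z3 z4 z5 z6 $ 1 $ 4 = z4" "coord_vec z1 z2 z3 z4 z5 z6 $ 2 $ 3 = z3"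
  "coord_vec z1 z2 z3 z4 z5 z6 $ 2 $ 4 = - z2" "coord_vec z1 z2 z3 z4 z5 z6 $ 3 $ 4 = z1"
  by (simp_all add: coord_vec_def cscale_def wedge_def axis_def)

lemma ext2_skew:
  assumes "M \<in> ext2"
  shows "M $ i $ j = - M $ j $ i"
  using arg_cong[OF assms[unfolded ext2_def, simplified], of "\<lambda>A. A $ j $ i"]
  by (simp add: transpose_def)

lemma ext2I:
  assumes "\<And>i j. M $ i $ j = - M $ j $ i"
  shows "M \<in> ext2"
proof -
  have "transpose M $ i $ j = (- M) $ i $ j" for i j
    using assms[of j i] by (simp add: transpose_def)
  then show ?thesis by (simp add: ext2_def vec_eq_iff)
qed

lemma ext2_add:
  assumes "M \<in> ext2" "N \<in> ext2"
  shows "M + N \<in> ext2"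
proof (rule ext2I)
  fix i j show "(M + N) $ i $ j = - (M + N) $ j $ i"
    using ext2_skew[OF assms(1), of i j] ext2_skew[OF assms(2), of i j] by simp
qed

lemma ext2_cscale:
  assumes "M \<in> ext2"
  shows "cscale c M \<in> ext2"
proof (rule ext2I)
  fix i j show "cscale c M $ i $ j = - cscale c M $ j $ i"
    using ext2_skew[OF assms(1), of i j] by (simp add: cscale_def)
qed

lemma ext2_uminus:
  assumes "M \<in> ext2"
  shows "- M \<in> ext2"
proof (rule ext2I)
  fix i j show "(- M) $ i $ j = - (- M) $ j $ i"
    using ext2_skew[OF assms(1), of i j] by simp
qed

lemma coord_vec_in_ext2: "coord_vec z1 z2 z3 z4 z5 z6 \<in> ext2"
  unfolding coord_vec_def by (intro ext2_add ext2_cscale ext2_uminus wedge_in_ext2)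

lemma ext2_eqI:
  assumes "M \<in> ext2" "N \<in> ext2"
    and "M $ 1 $ 2 = N $ 1 $ 2" "M $ 1 $ 3 = N $ 1 $ 3" "M $ 1 $ 4 = N $ 1 $ 4"
    and "M $ 2 $ 3 = N $ 2 $ 3" "M $ 2 $ 4 = N $ 2 $ 4" "M $ 3 $ 4 = N $ 3 $ 4"
  shows "M = N"
proof -
  have d: "A $ i $ i = 0" if "A \<in> ext2" for A i
    using ext2_skew[OF that, of i i] by simp
  show ?thesis
    unfolding vec_eq_iff forall_4
    using assms(3-) d[OF assms(1)] d[OF assms(2)]
      ext2_skew[OF assms(1), of 2 1] ext2_skew[OF assms(1), of 3 1] ext2_skew[OF assms(1), of 4 1]
      ext2_skew[OF assms(1), of 3 2] ext2_skew[OF assms(1), of 4 2] ext2_skew[OF assms(1), of 4 3]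
      ext2_skew[OF assms(2), of 2 1] ext2_skew[OF assms(2), of 3 1] ext2_skew[OF assms(2), of 4 1]
      ext2_skew[OF assms(2), of 3 2] ext2_skew[OF assms(2), of 4 2] ext2_skew[OF assms(2), of 4 3]
    by simp
qed

lemma ext2_coordinates:
  "M \<in> ext2 \<longleftrightarrow> (\<exists>z1 z2 z3 z4 z5 z6. M = coord_vec z1 z2 z3 z4 z5 z6)"
  "coord_vec z1 z2 z3 z4 z5 z6 = coord_vec w1 w2 w3 w4 w5 w6 \<longleftrightarrow>
     z1 = w1 \<and> z2 = w2 \<and> z3 = w3 \<and> z4 = w4 \<and> z5 = w5 \<and> z6 = w6"
proof -
  show "M \<in> ext2 \<longleftrightarrow> (\<exists>z1 z2 z3 z4 z5 z6. M = coord_vec z1 z2 z3 z4 z5 z6)"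
  proof
    assume M: "M \<in> ext2"
    have "M = coord_vec (M $ 3 $ 4) (- M $ 2 $ 4) (M $ 2 $ 3) (M $ 1 $ 4) (- M $ 1 $ 3) (M $ 1 $ 2)"
      by (rule ext2_eqI[OF M coord_vec_in_ext2]) (simp_all add: coord_vec_nth)
    then show "\<exists>z1 z2 z3 z4 z5 z6. M = coord_vec z1 z2 z3 z4 z5 z6" by blast
  qed (auto simp: coord_vec_in_ext2)
  show "coord_vec z1 z2 z3 z4 z5 z6 = coord_vec w1 w2 w3 w4 w5 w6 \<longleftrightarrow>
     z1 = w1 \<and> z2 = w2 \<and> z3 = w3 \<and> z4 = w4 \<and> z5 = w5 \<and> z6 = w6"
    by (metis coord_vec_nth neg_equal_iff_equal)
qed

lemma ext2_act_wedge: "ext2_act T (wedge u v) = wedge (T *v u) (T *v v)"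
  by (simp add: ext2_act_def wedge_def vec_eq_iff matrix_matrix_mult_def matrix_vector_mult_def
      transpose_def sum_4 algebra_simps)

lemma ext2_act_add: "ext2_act T (M + N) = ext2_act T M + ext2_act T N"
  by (simp add: ext2_act_def vec_eq_iff matrix_matrix_mult_def transpose_def
      sum.distrib algebra_simps)

lemma ext2_act_cscale: "ext2_act T (cscale c M) = cscale c (ext2_act T M)"
  by (simp add: ext2_act_def cscale_def vec_eq_iff matrix_matrix_mult_def transpose_def
      sum_distrib_left sum_distrib_right ac_simps)

lemma ext2_act_mult: "ext2_act (S ** T) M = ext2_act S (ext2_act T M)"
  by (simp add: ext2_act_def matrix_transpose_mul matrix_mul_assoc)

lemma ext2_act_one: "ext2_act (mat 1) M = M"
  by (simp add: ext2_act_def)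

lemma ext2_act_in_ext2:
  assumes "M \<in> ext2"
  shows "ext2_act T M \<in> ext2"
proof -
  have neg: "A ** (- B) = - (A ** B)" "(- A) ** B = - (A ** B)" for A B :: "complex^4^4"
    by (simp_all add: vec_eq_iff matrix_matrix_mult_def sum_negf)
  have "transpose (ext2_act T M) = T ** transpose M ** transpose T"
    by (simp add: ext2_act_def matrix_transpose_mul matrix_mul_assoc)
  also have "\<dots> = - ext2_act T M"
    using assms by (simp add: ext2_act_def ext2_def neg)
  finally show ?thesis by (simp add: ext2_def)
qed


section \<open>The projective space of the exterior square\<close>

text \<open>Points are the one-dimensional complex subspaces.\<close>

definition cline :: "complex^4^4 \<Rightarrow> (complex^4^4) set" where
  "cline M = {cscale c M | c. True}"

definition proj_ext2 :: "(complex^4^4) set set" where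
  "proj_ext2 = {cline M | M. M \<in> ext2 \<and> M \<noteq> 0}"

definition hpoint ::
  "complex \<Rightarrow> complex \<Rightarrow> complex \<Rightarrow> complex \<Rightarrow> complex \<Rightarrow> complex \<Rightarrow> (complex^4^4) set" where
  "hpoint z1 z2 z3 z4 z5 z6 = cline (coord_vec z1 z2 z3 z4 z5 z6)"


section \<open>The groups and the action\<close>

definition rhoH :: "(complex^2^2) set" where
  "rhoH = {vector [vector [z, - cnj w], vector [w, cnj z]] | z w. True}"

definition block :: "complex^2^2 \<Rightarrow> complex^2^2 \<Rightarrow> complex^2^2 \<Rightarrow> complex^2^2 \<Rightarrow> complex^4^4" where
  "block A B C D = vector
     [vector [A$1$1, A$1$2, B$1$1, B$1$2],
      vector [A$2$1, A$2$2, B$2$1, B$2$2],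
      vector [C$1$1, C$1$2, D$1$1, D$1$2],
      vector [C$2$1, C$2$2, D$2$1, D$2$2]]"

definition GL2H :: "(complex^4^4) monoid" where
  "GL2H = \<lparr>carrier = {T. invertible T \<and>
       (\<exists>A\<in>rhoH. \<exists>B\<in>rhoH. \<exists>C\<in>rhoH. \<exists>D\<in>rhoH. T = block A B C D)},
     mult = (**), one = mat 1\<rparr>"

definition real_scalars :: "(complex^4^4) set" where
  "real_scalars = {mat (complex_of_real r) | r. r \<noteq> 0}"

definition PGL2H :: "(complex^4^4) set monoid" where
  "PGL2H = GL2H Mod real_scalars"

text \<open>An element of \<open>PGL2H\<close> is a coset \<open>C\<close>.  Its representatives differ by scalars, so they all
  map a line to the same line, and the set below is the common image.\<close>

definition proj_act :: "(complex^4^4) set \<Rightarrow> (complex^4^4) set \<Rightarrow> (complex^4^4) set" where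
  "proj_act C = (\<lambda>p\<in>proj_ext2. {ext2_act T M | T M. T \<in> C \<and> M \<in> p})"


section \<open>The list of representatives\<close>

datatype orbit_type =
    RealNull
  | NonrealIsotropic
  | RealTimelike
  | RealSpacelike
  | NonrealDegenerate
  | NonrealLorentzian real
  | NonrealNegdef real

definition orbit_types :: "orbit_type set" where
  "orbit_types =
     {RealNull, NonrealIsotropic, RealTimelike, RealSpacelike, NonrealDegenerate}
     \<union> {NonrealLorentzian \<theta> | \<theta>. 0 < \<theta> \<and> \<theta> < pi}
     \<union> {NonrealNegdef l | l. 0 < l \<and> l < 1}"

fun representative :: "orbit_type \<Rightarrow> (complex^4^4) set" where
  "representative RealNull = hpoint 0 0 0 0 0 1"
| "representative NonrealIsotropic = hpoint (-1) 0 (-\<i>) \<i> 0 1"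
| "representative RealTimelike = hpoint 1 0 0 0 0 1"
| "representative RealSpacelike = hpoint 1 0 0 0 0 (-1)"
| "representative NonrealDegenerate = hpoint 0 0 (-\<i>) \<i> 0 1"
| "representative (NonrealLorentzian \<theta>) = hpoint (exp (\<i> * complex_of_real \<theta>)) 0 0 0 0 1"
| "representative (NonrealNegdef l) =
     hpoint 1 0 (- (\<i> * complex_of_real l)) (\<i> * complex_of_real l) 0 (-1)"


section \<open>Well-definedness\<close>

lemma hpoint_in_proj_ext2:
  assumes "(z1, z2, z3, z4, z5, z6) \<noteq> (0, 0, 0, 0, 0, 0)"
  shows "hpoint z1 z2 z3 z4 z5 z6 \<in> proj_ext2"
proof -
  have "coord_vec z1 z2 z3 z4 z5 z6 \<noteq> 0"
  proof
    assume "coord_vec z1 z2 z3 z4 z5 z6 = 0"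
    then have "z6 = 0" "- z5 = 0" "z4 = 0" "z3 = 0" "- z2 = 0" "z1 = 0"
      using coord_vec_nth[of z1 z2 z3 z4 z5 z6] by simp_all
    then show False using assms by simp
  qed
  then show ?thesis
    unfolding hpoint_def proj_ext2_def using coord_vec_in_ext2 by blast
qed

lemma representative_in_proj_ext2: "representative t \<in> proj_ext2"
  by (cases t) (auto intro!: hpoint_in_proj_ext2)

text \<open>\<open>quatJ\<close> composed with complex conjugation is the quaternionic structure on \<open>\<complex>\<^sup>4\<close>; the matrices
  with blocks in \<open>rhoH\<close> are those commuting with it.\<close>

definition quatJ :: "complex^4^4" where
  "quatJ = block (vector [vector [0, -1], vector [1, 0]]) 0 0 (vector [vector [0, -1], vector [1, 0]])"

lemma vector_4_nth:
  "(vector [a, b, c, d] :: 'a::zero^4) $ 1 = a" "(vector [a, b, c, d] :: 'a::zero^4) $ 2 = b"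
  "(vector [a, b, c, d] :: 'a::zero^4) $ 3 = c" "(vector [a, b, c, d] :: 'a::zero^4) $ 4 = d"
  by (simp_all add: vector_def)

lemma block_nth:
  "block A B C D $ 1 $ 1 = A $ 1 $ 1" "block A B C D $ 1 $ 2 = A $ 1 $ 2"
  "block A B C D $ 2 $ 1 = A $ 2 $ 1" "block A B C D $ 2 $ 2 = A $ 2 $ 2"
  "block A B C D $ 1 $ 3 = B $ 1 $ 1" "block A B C D $ 1 $ 4 = B $ 1 $ 2"
  "block A B C D $ 2 $ 3 = B $ 2 $ 1" "block A B C D $ 2 $ 4 = B $ 2 $ 2"
  "block A B C D $ 3 $ 1 = C $ 1 $ 1" "block A B C D $ 3 $ 2 = C $ 1 $ 2"
  "block A B C D $ 4 $ 1 = C $ 2 $ 1" "block A B C D $ 4 $ 2 = C $ 2 $ 2"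
  "block A B C D $ 3 $ 3 = D $ 1 $ 1" "block A B C D $ 3 $ 4 = D $ 1 $ 2"
  "block A B C D $ 4 $ 3 = D $ 2 $ 1" "block A B C D $ 4 $ 4 = D $ 2 $ 2"
  by (simp_all add: block_def vector_4_nth)

lemma mult_quatJ_nth:
  "(T ** quatJ) $ i $ 1 = T $ i $ 2" "(T ** quatJ) $ i $ 2 = - T $ i $ 1"
  "(T ** quatJ) $ i $ 3 = T $ i $ 4" "(T ** quatJ) $ i $ 4 = - T $ i $ 3"
  "(quatJ ** S) $ 1 $ j = - S $ 2 $ j" "(quatJ ** S) $ 2 $ j = S $ 1 $ j"
  "(quatJ ** S) $ 3 $ j = - S $ 4 $ j" "(quatJ ** S) $ 4 $ j = S $ 3 $ j"
  by (simp_all add: matrix_matrix_mult_def sum_4 quatJ_def block_nth)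

lemma quatJ_commute_iff:
  "T ** quatJ = quatJ ** map_matrix cnj T \<longleftrightarrow>
     T $ 1 $ 2 = - cnj (T $ 2 $ 1) \<and> T $ 2 $ 2 = cnj (T $ 1 $ 1) \<and>
     T $ 1 $ 4 = - cnj (T $ 2 $ 3) \<and> T $ 2 $ 4 = cnj (T $ 1 $ 3) \<and>
     T $ 3 $ 2 = - cnj (T $ 4 $ 1) \<and> T $ 4 $ 2 = cnj (T $ 3 $ 1) \<and>
     T $ 3 $ 4 = - cnj (T $ 4 $ 3) \<and> T $ 4 $ 4 = cnj (T $ 3 $ 3)" (is "?L \<longleftrightarrow> ?R")
proof
  assume ?L
  then have *: "(T ** quatJ) $ i $ j = (quatJ ** map_matrix cnj T) $ i $ j" for i j by simp
  show ?R
    using *[of 1 1] *[of 2 1] *[of 1 3] *[of 2 3] *[of 3 1] *[of 4 1] *[of 3 3] *[of 4 3]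
    unfolding mult_quatJ_nth nth_map_matrix by blast
next
  assume ?R
  then show ?L
    unfolding vec_eq_iff forall_4 mult_quatJ_nth nth_map_matrix by simp
qed

lemma quaternionic_iff:
  "(\<exists>A\<in>rhoH. \<exists>B\<in>rhoH. \<exists>C\<in>rhoH. \<exists>D\<in>rhoH. T = block A B C D) \<longleftrightarrow>
     T ** quatJ = quatJ ** map_matrix cnj T" (is "?L \<longleftrightarrow> ?R")
proof
  have q: "A $ 1 $ 2 = - cnj (A $ 2 $ 1) \<and> A $ 2 $ 2 = cnj (A $ 1 $ 1)" if "A \<in> rhoH" for A
    using that by (auto simp: rhoH_def)
  assume ?L
  then obtain A B C D where "A \<in> rhoH" "B \<in> rhoH" "C \<in> rhoH" "D \<in> rhoH" "T = block A B C D"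
    by blast
  then show ?R
    unfolding quatJ_commute_iff by (simp add: block_nth q)
next
  assume ?R
  define q where "q z w = (vector [vector [z, - cnj w], vector [w, cnj z]] :: complex^2^2)" for z w
  have "T = block (q (T$1$1) (T$2$1)) (q (T$1$3) (T$2$3)) (q (T$3$1) (T$4$1)) (q (T$3$3) (T$4$3))"
    using \<open>?R\<close>[unfolded quatJ_commute_iff]
    unfolding vec_eq_iff forall_4 block_nth q_def by simp
  moreover have "q z w \<in> rhoH" for z w
    unfolding q_def rhoH_def by blast
  ultimately show ?L by blast
qed

lemma map_matrix_cnj_mult:
  "map_matrix cnj (S ** T) = map_matrix cnj S ** map_matrix cnj (T :: complex^4^4)"
  by (simp add: vec_eq_iff matrix_matrix_mult_def)

lemma carrier_GL2H:
  "carrier GL2H = {T. invertible T \<and> T ** quatJ = quatJ ** map_matrix cnj T}"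
  by (simp add: GL2H_def quaternionic_iff)

lemma map_matrix_cnj_mat: "map_matrix cnj (mat c :: complex^4^4) = mat (cnj c)"
  by (simp add: vec_eq_iff mat_def)

lemma mat_mult_cscale: "mat c ** M = cscale c M" "M ** mat c = cscale c M"
proof -
  show "mat c ** M = cscale c M"
    unfolding vec_eq_iff forall_4 by (simp add: matrix_matrix_mult_def mat_def cscale_def sum_4)
  show "M ** mat c = cscale c M"
    unfolding vec_eq_iff forall_4 by (simp add: matrix_matrix_mult_def mat_def cscale_def sum_4)
qed


lemma mat_mult_mat: "mat a ** mat b = (mat (a * b) :: complex^4^4)"
  unfolding mat_mult_cscale(1) by (simp add: cscale_def mat_def vec_eq_iff)

lemma GL2H_mult: "S \<otimes>\<^bsub>GL2H\<^esub> T = S ** T" and GL2H_one: "\<one>\<^bsub>GL2H\<^esub> = mat 1"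
  by (simp_all add: GL2H_def)

theorem group_GL2H: "group GL2H"
proof (rule groupI)
  fix S T assume "S \<in> carrier GL2H" "T \<in> carrier GL2H"
  then have *: "invertible S" "invertible T" "S ** quatJ = quatJ ** map_matrix cnj S"
    "T ** quatJ = quatJ ** map_matrix cnj T" by (auto simp: carrier_GL2H)
  have "S ** T ** quatJ = quatJ ** map_matrix cnj (S ** T)"
  proof -
    have "S ** T ** quatJ = S ** (T ** quatJ)" by (simp only: matrix_mul_assoc)
    also have "\<dots> = S ** quatJ ** map_matrix cnj T" unfolding *(4) by (simp only: matrix_mul_assoc)
    also have "\<dots> = quatJ ** map_matrix cnj (S ** T)"
      unfolding *(3) map_matrix_cnj_mult by (simp only: matrix_mul_assoc)
    finally show ?thesis .
  qed
  then show "S \<otimes>\<^bsub>GL2H\<^esub> T \<in> carrier GL2H"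
  proof -
    have "S \<otimes>\<^bsub>GL2H\<^esub> T = S ** T" by (simp add: GL2H_def)
    then show ?thesis
      using * \<open>S ** T ** quatJ = quatJ ** map_matrix cnj (S ** T)\<close>
      by (simp only: carrier_GL2H mem_Collect_eq invertible_mult)
  qed
next
  show "\<one>\<^bsub>GL2H\<^esub> \<in> carrier GL2H"
  proof -
    have "invertible (mat 1 :: complex^4^4)"
      unfolding invertible_def by (rule exI[of _ "mat 1"]) simp
    moreover have "\<one>\<^bsub>GL2H\<^esub> = mat 1" by (simp add: GL2H_def)
    ultimately show ?thesis by (simp add: carrier_GL2H map_matrix_cnj_mat)
  qed
next
  fix T assume "T \<in> carrier GL2H"
  then have *: "invertible T" "T ** quatJ = quatJ ** map_matrix cnj T" by (auto simp: carrier_GL2H)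
  then obtain S where S: "S ** T = mat 1" "T ** S = mat 1" unfolding invertible_def by blast
  have "map_matrix cnj T ** map_matrix cnj S = mat 1"
    using arg_cong[OF S(2), of "map_matrix cnj"] by (simp add: map_matrix_cnj_mult map_matrix_cnj_mat)
  then have "S ** quatJ = quatJ ** map_matrix cnj S"
  proof -
    assume inv: "map_matrix cnj T ** map_matrix cnj S = mat 1"
    have "S ** quatJ = S ** quatJ ** (map_matrix cnj T ** map_matrix cnj S)" by (simp add: inv)
    also have "\<dots> = S ** (quatJ ** map_matrix cnj T) ** map_matrix cnj S"
      by (simp only: matrix_mul_assoc)
    also have "\<dots> = (S ** T) ** quatJ ** map_matrix cnj S"
      unfolding *(2)[symmetric] by (simp only: matrix_mul_assoc)
    finally show ?thesis by (simp add: S(1))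
  qed
  moreover have "invertible S" using S invertible_def by blast
  ultimately have "S \<in> carrier GL2H" unfolding carrier_GL2H by blast
  moreover have "S \<otimes>\<^bsub>GL2H\<^esub> T = \<one>\<^bsub>GL2H\<^esub>" unfolding GL2H_mult GL2H_one by (rule S(1))
  ultimately show "\<exists>S\<in>carrier GL2H. S \<otimes>\<^bsub>GL2H\<^esub> T = \<one>\<^bsub>GL2H\<^esub>" by blast
next
  fix R S T
  show "R \<otimes>\<^bsub>GL2H\<^esub> S \<otimes>\<^bsub>GL2H\<^esub> T = R \<otimes>\<^bsub>GL2H\<^esub> (S \<otimes>\<^bsub>GL2H\<^esub> T)"
    unfolding GL2H_mult by (rule matrix_mul_assoc[symmetric])
next
  fix T show "\<one>\<^bsub>GL2H\<^esub> \<otimes>\<^bsub>GL2H\<^esub> T = T"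
    unfolding GL2H_mult GL2H_one by (rule matrix_mul_lid)
qed

lemma real_scalars_subset: "real_scalars \<subseteq> carrier GL2H"
proof
  fix T assume "T \<in> real_scalars"
  then obtain r where r: "r \<noteq> 0" "T = mat (complex_of_real r)" by (auto simp: real_scalars_def)
  have "T ** mat (complex_of_real (inverse r)) = mat 1" "mat (complex_of_real (inverse r)) ** T = mat 1"
    using r by (simp_all add: mat_mult_mat)
  then have "invertible T" unfolding invertible_def by blast
  then show "T \<in> carrier GL2H"
    using r by (simp add: carrier_GL2H map_matrix_cnj_mat mat_mult_cscale)
qed

theorem normal_real_scalars: "real_scalars \<lhd> GL2H"
proof (rule group.normalI[OF group_GL2H])
  interpret group GL2H by (rule group_GL2H)
  have m: "mat (complex_of_real r) ** mat (complex_of_real s) = (mat (complex_of_real (r * s)) :: complex^4^4)"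
    for r s
    by (simp add: mat_mult_mat)
  have one: "\<one>\<^bsub>GL2H\<^esub> = mat 1" and mult: "S \<otimes>\<^bsub>GL2H\<^esub> T = S ** T" for S T
    by (simp_all add: GL2H_def)
  show "subgroup real_scalars GL2H"
  proof (rule subgroupI[OF real_scalars_subset])
    show "real_scalars \<noteq> {}" unfolding real_scalars_def using zero_neq_one[where 'a = real] by blast
  next
    fix S T assume "S \<in> real_scalars" "T \<in> real_scalars"
    then obtain r s where "r \<noteq> 0" "S = mat (complex_of_real r)" "s \<noteq> 0" "T = mat (complex_of_real s)"
      unfolding real_scalars_def by blast
    then have "r * s \<noteq> 0" "S \<otimes>\<^bsub>GL2H\<^esub> T = mat (complex_of_real (r * s))"
      by (simp_all only: mult m mult_eq_0_iff) simp
    then show "S \<otimes>\<^bsub>GL2H\<^esub> T \<in> real_scalars"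
      unfolding real_scalars_def by blast
  next
    fix T assume "T \<in> real_scalars"
    then obtain r where r: "r \<noteq> 0" "T = mat (complex_of_real r)" by (auto simp: real_scalars_def)
    have "mat (complex_of_real (inverse r)) \<in> real_scalars"
      unfolding real_scalars_def
      by (intro CollectI exI[of _ "inverse r"] conjI refl) (simp add: r)
    moreover have "mat (complex_of_real (inverse r)) \<otimes>\<^bsub>GL2H\<^esub> T = \<one>\<^bsub>GL2H\<^esub>"
      using r by (simp only: mult one m) simp
    ultimately show "inv\<^bsub>GL2H\<^esub> T \<in> real_scalars"
      using inv_equality[of "mat (complex_of_real (inverse r))" T] \<open>T \<in> real_scalars\<close>
        real_scalars_subset by (simp add: subset_iff)
  qed
  show "\<forall>T\<in>carrier GL2H. real_scalars #>\<^bsub>GL2H\<^esub> T = T <#\<^bsub>GL2H\<^esub> real_scalars"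
    by (auto simp: r_coset_def l_coset_def mult real_scalars_def mat_mult_cscale)
qed

corollary group_PGL2H: "group PGL2H"
  unfolding PGL2H_def by (rule normal.factorgroup_is_group[OF normal_real_scalars])

lemma proj_act_coset:
  assumes "T \<in> carrier GL2H" "M \<in> ext2" "M \<noteq> 0"
  shows "proj_act (real_scalars #>\<^bsub>GL2H\<^esub> T) (cline M) = cline (ext2_act T M)"
proof -
  have cos: "real_scalars #>\<^bsub>GL2H\<^esub> T = {cscale (complex_of_real r) T | r. r \<noteq> 0}"
    by (auto simp: r_coset_def real_scalars_def GL2H_def mat_mult_cscale)
  have sc: "ext2_act (cscale c T) N = cscale (c * c) (ext2_act T N)" for c T N
    by (simp add: ext2_act_def cscale_def vec_eq_iff matrix_matrix_mult_def transpose_def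
        sum_distrib_left sum_distrib_right ac_simps)
  have ss: "cscale a (cscale b N) = cscale (a * b) N" for a b N
    by (simp add: cscale_def vec_eq_iff ac_simps)
  have one: "cscale 1 T = T" by (simp add: cscale_def vec_eq_iff)
  have mem: "cline M \<in> proj_ext2" using assms unfolding proj_ext2_def by blast
  have img: "ext2_act (cscale a T) (cscale c M) = cscale (a * a * c) (ext2_act T M)" for a c
    by (simp add: sc ss ext2_act_cscale ac_simps)
  show ?thesis
  proof (intro equalityI subsetI)
    fix N assume "N \<in> proj_act (real_scalars #>\<^bsub>GL2H\<^esub> T) (cline M)"
    then obtain r c where "N = ext2_act (cscale (complex_of_real r) T) (cscale c M)"
      using mem unfolding proj_act_def cos cline_def restrict_def by auto
    then show "N \<in> cline (ext2_act T M)"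
      unfolding cline_def img by blast
  next
    fix N assume "N \<in> cline (ext2_act T M)"
    then obtain c where "N = cscale c (ext2_act T M)" unfolding cline_def by blast
    then have "N = ext2_act (cscale (complex_of_real 1) T) (cscale c M)"
      by (simp add: one ext2_act_cscale)
    moreover have "cscale (complex_of_real 1) T \<in> real_scalars #>\<^bsub>GL2H\<^esub> T"
      unfolding cos by (intro CollectI exI[of _ 1]) simp
    moreover have "cscale c M \<in> cline M" unfolding cline_def by blast
    ultimately show "N \<in> proj_act (real_scalars #>\<^bsub>GL2H\<^esub> T) (cline M)"
      using mem unfolding proj_act_def restrict_def by auto
  qed
qed

lemma ext2_act_nonzero:
  assumes "T \<in> carrier GL2H" "M \<noteq> 0"
  shows "ext2_act T M \<noteq> 0"
proof
  assume *: "ext2_act T M = 0"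
  obtain S where "S ** T = mat 1" using assms(1) by (auto simp: carrier_GL2H invertible_def)
  then have "M = ext2_act S (ext2_act T M)" by (metis ext2_act_mult ext2_act_one)
  also have "\<dots> = 0" by (simp add: *) (simp add: ext2_act_def)
  finally show False using assms(2) by simp
qed

theorem group_action_proj_act: "group_action PGL2H proj_ext2 proj_act"
proof -
  interpret G: group GL2H by (rule group_GL2H)
  interpret N: normal real_scalars GL2H by (rule normal_real_scalars)
  have car: "carrier PGL2H = (\<lambda>T. real_scalars #>\<^bsub>GL2H\<^esub> T) ` carrier GL2H"
    by (simp add: PGL2H_def carrier_FactGroup)
  have mult: "S \<otimes>\<^bsub>GL2H\<^esub> T = S ** T" for S T by (simp add: GL2H_def)
  have repr: thesis
    if "C \<in> carrier PGL2H" "\<And>T. T \<in> carrier GL2H \<Longrightarrow> C = real_scalars #>\<^bsub>GL2H\<^esub> T \<Longrightarrow> thesis"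
    for C thesis
    using that(1) unfolding car by (rule imageE) (rule that(2))
  have line: thesis
    if "p \<in> proj_ext2" "\<And>M. M \<in> ext2 \<Longrightarrow> M \<noteq> 0 \<Longrightarrow> p = cline M \<Longrightarrow> thesis"
    for p thesis
    using that(1) unfolding proj_ext2_def mem_Collect_eq by (elim exE conjE) (rule that(2))
  have maps: "proj_act C p \<in> proj_ext2" if C: "C \<in> carrier PGL2H" and p: "p \<in> proj_ext2" for C p
  proof -
    obtain T where T: "T \<in> carrier GL2H" "C = real_scalars #>\<^bsub>GL2H\<^esub> T"
      by (rule repr[OF C])
    obtain M where M: "M \<in> ext2" "M \<noteq> 0" "p = cline M"
      by (rule line[OF p])
    have "proj_act C p = cline (ext2_act T M)"
      unfolding T(2) M(3) by (rule proj_act_coset[OF T(1) M(1,2)])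
    then show ?thesis
      using ext2_act_in_ext2[OF M(1)] ext2_act_nonzero[OF T(1) M(2)] unfolding proj_ext2_def by blast
  qed
  have comp: "proj_act (C \<otimes>\<^bsub>PGL2H\<^esub> D) p = proj_act C (proj_act D p)"
    if C: "C \<in> carrier PGL2H" and D: "D \<in> carrier PGL2H" and p: "p \<in> proj_ext2" for C D p
  proof -
    obtain S where S: "S \<in> carrier GL2H" "C = real_scalars #>\<^bsub>GL2H\<^esub> S" by (rule repr[OF C])
    obtain T where T: "T \<in> carrier GL2H" "D = real_scalars #>\<^bsub>GL2H\<^esub> T" by (rule repr[OF D])
    obtain M where M: "M \<in> ext2" "M \<noteq> 0" "p = cline M" by (rule line[OF p])
    have "C \<otimes>\<^bsub>PGL2H\<^esub> D = real_scalars #>\<^bsub>GL2H\<^esub> (S ** T)"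
      using S T N.rcos_sum[of S T] by (simp add: PGL2H_def mult)
    moreover have "S ** T \<in> carrier GL2H" using G.m_closed[OF S(1) T(1)] by (simp only: mult)
    ultimately show ?thesis
      using S T M
      by (simp only: proj_act_coset ext2_act_in_ext2 ext2_act_nonzero ext2_act_mult not_False_eq_True)
  qed
  have one: "proj_act \<one>\<^bsub>PGL2H\<^esub> p = p" if p: "p \<in> proj_ext2" for p
  proof -
    obtain M where M: "M \<in> ext2" "M \<noteq> 0" "p = cline M" by (rule line[OF p])
    have "\<one>\<^bsub>PGL2H\<^esub> = real_scalars #>\<^bsub>GL2H\<^esub> \<one>\<^bsub>GL2H\<^esub>"
      using G.coset_mult_one[OF real_scalars_subset] by (simp add: PGL2H_def)
    then have "proj_act \<one>\<^bsub>PGL2H\<^esub> p = cline (ext2_act \<one>\<^bsub>GL2H\<^esub> M)"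
      using proj_act_coset[OF G.one_closed M(1,2)] M(3) by simp
    then show ?thesis using M by (simp add: GL2H_def ext2_act_one)
  qed
  interpret P: group PGL2H by (rule group_PGL2H)
  have bij: "proj_act C \<in> Bij proj_ext2" if C: "C \<in> carrier PGL2H" for C
  proof -
    have "bij_betw (proj_act C) proj_ext2 proj_ext2"
    proof (rule bij_betw_byWitness[where f' = "proj_act (inv\<^bsub>PGL2H\<^esub> C)"])
      show "\<forall>p\<in>proj_ext2. proj_act (inv\<^bsub>PGL2H\<^esub> C) (proj_act C p) = p"
        using C by (metis P.inv_closed P.l_inv comp one)
      show "\<forall>p\<in>proj_ext2. proj_act C (proj_act (inv\<^bsub>PGL2H\<^esub> C) p) = p"
        using C by (metis P.inv_closed P.r_inv comp one)
    qed (use C maps P.inv_closed in auto)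
    then show ?thesis by (simp add: Bij_def proj_act_def)
  qed
  have "proj_act \<in> hom PGL2H (BijGroup proj_ext2)"
  proof (rule homI)
    fix C D assume CD: "C \<in> carrier PGL2H" "D \<in> carrier PGL2H"
    show "proj_act (C \<otimes>\<^bsub>PGL2H\<^esub> D) = proj_act C \<otimes>\<^bsub>BijGroup proj_ext2\<^esub> proj_act D"
    proof
      fix p
      show "proj_act (C \<otimes>\<^bsub>PGL2H\<^esub> D) p = (proj_act C \<otimes>\<^bsub>BijGroup proj_ext2\<^esub> proj_act D) p"
      proof (cases "p \<in> proj_ext2")
        case True
        then show ?thesis using CD bij comp by (simp add: BijGroup_def compose_def)
      next
        case False
        then show ?thesis using CD bij by (simp add: BijGroup_def compose_def proj_act_def)
      qed
    qed
  qed (simp add: BijGroup_def bij)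
  then show ?thesis
    by (simp add: group_action_def group_hom_def group_hom_axioms_def group_PGL2H group_BijGroup)
qed

end

theory Submission
  imports Defs
begin

text \<open>
The skew matrices carry the Pfaffian, a complex quadratic form, and a real structure \<open>conjJ\<close> for which
the real points form a quadratic space of signature \<open>(1, 5)\<close>.  Every \<open>T\<close> in \<open>GL(2, H)\<close> commutes with the
real structure and multiplies the Pfaffian by a positive number, so the group acts on the real
six-space by conformal Lorentz transformations.  A complex line is spanned by \<open>x + \<i> y\<close> with \<open>x\<close>, \<open>y\<close>
real, and the theorem classifies the spans of \<open>x\<close> and \<open>y\<close>, with their conformal structure, by signature.

Distinct entries lie in different orbits because three things depend on the orbit alone: whether the
point is real, whether the Pfaffian and the Hermitian form \<open>hform\<close> vanish, and the quotient \<open>ratio\<close> of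
\<open>hform\<close> by the absolute value of the Pfaffian (\<open>invariants_equiv\<close>).  The quotient keeps its sign because
the multiplier is positive (\<open>multiplier_pos\<close>).  The values on the list separate it
(\<open>rep_mat_inj\<close>).

That every point lies in one of the listed orbits is a reduction by explicit quaternionic matrices.  A point is
written as a complexified quaternionic Hermitian matrix \<open>[[a, P], [adj P, b]]\<close>.  If \<open>a\<close> is nonzero, completing
the square makes \<open>P\<close> either \<open>0\<close>, so that \<open>b = 0\<close> or only the phase of \<open>b / a\<close> matters
(\<open>classified_diagonal\<close>), or the imaginary scalar \<open>\<i>\<close>.  In the second case the point either is
diagonalised or is brought to \<open>b = 0\<close> (\<open>classified_imaginary_scalar\<close>).  For \<open>b = 0\<close> and \<open>P \<noteq> 0\<close>, one quaternionic multiplication turns \<open>P\<close> into a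
Hermitian matrix, a second one diagonalises it, and the ratio of its eigenvalues gives the negative
definite family with its limits, or the degenerate point if \<open>a\<close> cannot be removed
(\<open>classified_bottom_zero\<close>).
\<close>

section \<open>Skew matrices as complexified quaternionic Hermitian matrices\<close>

text \<open>With \<open>\<epsilon> = [[0, 1], [-1, 0]]\<close> and \<open>P = [[p, q], [r, s]]\<close>, this is the skew matrix with blocks
\<open>[[a \<epsilon>, P \<epsilon>], [-(P \<epsilon>)\<^sup>T, b \<epsilon>]]\<close>.  Since \<open>\<epsilon> D\<^sup>T = D\<^sup>* \<epsilon>\<close> for \<open>D\<close> in \<open>rhoH\<close>, the group
acts on it as on \<open>X = [[a, P], [adj P, b]]\<close> by \<open>X \<mapsto> T X T\<^sup>*\<close>.  The real points have \<open>a\<close>, \<open>b\<close> real and \<open>P\<close> a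
quaternion, for which \<open>adj P = P\<^sup>*\<close>, so \<open>X\<close> is then quaternionic Hermitian; a general point allows
complex \<open>a\<close>, \<open>b\<close> and any complex \<open>P\<close>.\<close>

definition biherm ::
  "complex \<Rightarrow> complex \<Rightarrow> complex \<Rightarrow> complex \<Rightarrow> complex \<Rightarrow> complex \<Rightarrow> complex^4^4" where
  "biherm a p q r s b = coord_vec b (- r) (- s) p q a"

definition qmat :: "complex \<Rightarrow> complex \<Rightarrow> complex^2^2" where
  "qmat z w = vector [vector [z, - cnj w], vector [w, cnj z]]"

definition hmat ::
  "complex \<Rightarrow> complex \<Rightarrow> complex \<Rightarrow> complex \<Rightarrow>
   complex \<Rightarrow> complex \<Rightarrow> complex \<Rightarrow> complex \<Rightarrow> complex^4^4" where
  "hmat a a' b b' c c' d d' = block (qmat a a') (qmat b b') (qmat c c') (qmat d d')"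

lemma qmat_nth:
  "qmat z w $ 1 $ 1 = z" "qmat z w $ 1 $ 2 = - cnj w" "qmat z w $ 2 $ 1 = w" "qmat z w $ 2 $ 2 = cnj z"
  by (simp_all add: qmat_def)

lemmas hmat_nth = block_nth[of "qmat _ _" "qmat _ _" "qmat _ _" "qmat _ _", folded hmat_def, unfolded qmat_nth]

lemma biherm_in_ext2: "biherm a p q r s b \<in> ext2"
  by (simp add: biherm_def coord_vec_in_ext2)

lemma ext2_diag: "M \<in> ext2 \<Longrightarrow> M $ i $ i = 0"
  using ext2_skew[of M i i] by simp

lemma biherm_nth:
  "biherm a p q r s b $ 1 $ 2 = a" "biherm a p q r s b $ 1 $ 3 = - q" "biherm a p q r s b $ 1 $ 4 = p"
  "biherm a p q r s b $ 2 $ 3 = - s" "biherm a p q r s b $ 2 $ 4 = r" "biherm a p q r s b $ 3 $ 4 = b"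
  "biherm a p q r s b $ 2 $ 1 = - a" "biherm a p q r s b $ 3 $ 1 = q" "biherm a p q r s b $ 4 $ 1 = - p"
  "biherm a p q r s b $ 3 $ 2 = s" "biherm a p q r s b $ 4 $ 2 = - r" "biherm a p q r s b $ 4 $ 3 = - b"
  "biherm a p q r s b $ i $ i = 0"
proof -
  note sk = ext2_skew[OF biherm_in_ext2[of a p q r s b]]
  show "biherm a p q r s b $ 2 $ 1 = - a" "biherm a p q r s b $ 3 $ 1 = q" "biherm a p q r s b $ 4 $ 1 = - p"
    "biherm a p q r s b $ 3 $ 2 = s" "biherm a p q r s b $ 4 $ 2 = - r" "biherm a p q r s b $ 4 $ 3 = - b"
    using sk[of 2 1] sk[of 3 1] sk[of 4 1] sk[of 3 2] sk[of 4 2] sk[of 4 3]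
    by (simp_all add: biherm_def coord_vec_nth)
qed (simp_all add: biherm_def coord_vec_nth ext2_diag coord_vec_in_ext2)

lemma ext2_biherm:
  "M \<in> ext2 \<Longrightarrow> M = biherm (M$1$2) (M$1$4) (- M$1$3) (M$2$4) (- M$2$3) (M$3$4)"
  by (rule ext2_eqI) (simp_all add: biherm_in_ext2 biherm_nth)

lemma biherm_eq_iff:
  "biherm a p q r s b = biherm a' p' q' r' s' b' \<longleftrightarrow>
     a = a' \<and> p = p' \<and> q = q' \<and> r = r' \<and> s = s' \<and> b = b'"
  unfolding biherm_def ext2_coordinates(2) by auto

lemma cscale_biherm: "cscale c (biherm a p q r s b) = biherm (c * a) (c * p) (c * q) (c * r) (c * s) (c * b)"
  by (rule ext2_eqI) (simp_all add: ext2_cscale biherm_in_ext2, simp_all add: cscale_def biherm_nth)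

lemma biherm_zero_iff: "biherm a p q r s b = 0 \<longleftrightarrow> a = 0 \<and> p = 0 \<and> q = 0 \<and> r = 0 \<and> s = 0 \<and> b = 0"
proof -
  have "0 = cscale 0 (biherm 0 0 0 0 0 0)" by (simp add: cscale_def vec_eq_iff)
  then have z: "0 = biherm 0 0 0 0 0 0" by (simp add: cscale_biherm)
  show ?thesis unfolding z biherm_eq_iff ..
qed

lemma act_nth:
  "ext2_act T M $ i $ j = (\<Sum>k\<in>UNIV. (\<Sum>l\<in>UNIV. T $ i $ l * M $ l $ k) * T $ j $ k)"
  by (simp add: ext2_act_def matrix_matrix_mult_def transpose_def)

section \<open>Elementary transformations\<close>

lemma hmat_in_GL2H:
  assumes "hmat a a' b b' c c' d d' ** S = mat 1"
  shows "hmat a a' b b' c c' d d' \<in> carrier GL2H"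
proof -
  have "invertible (hmat a a' b b' c c' d d')"
    using assms matrix_left_right_inverse unfolding invertible_def by blast
  moreover have "qmat z w \<in> rhoH" for z w unfolding rhoH_def qmat_def by blast
  ultimately show ?thesis unfolding GL2H_def hmat_def by simp blast
qed

lemma hmat_mult_nth: "(hmat a a' b b' c c' d d' ** S) $ i $ j
   = (\<Sum>k\<in>UNIV. hmat a a' b b' c c' d d' $ i $ k * S $ k $ j)"
  by (simp add: matrix_matrix_mult_def)

lemma mat_one_nth: "(mat 1 :: complex^4^4) $ i $ j = (if i = j then 1 else 0)"
  by (simp add: mat_def)

text \<open>The matrix \<open>diag(A, D)\<close> acts by \<open>(a, P, b) \<mapsto> (|A|\<^sup>2 a, A P D\<^sup>*, |D|\<^sup>2 b)\<close>.  Since \<open>A\<close> and \<open>D\<close>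
need not be unit quaternions, normalisations can be postponed to one final scaling.\<close>

lemma diag_move:
  assumes "(x, y) \<noteq> (0, 0)" "(z, w) \<noteq> (0, 0)"
  shows "hmat x y 0 0 0 0 z w \<in> carrier GL2H"
    and "ext2_act (hmat x y 0 0 0 0 z w) (biherm a p q r s b) =
      biherm ((x * cnj x + y * cnj y) * a)
        ((x * p - cnj y * r) * cnj z - (x * q - cnj y * s) * w)
        ((x * p - cnj y * r) * cnj w + (x * q - cnj y * s) * z)
        ((y * p + cnj x * r) * cnj z - (y * q + cnj x * s) * w)
        ((y * p + cnj x * r) * cnj w + (y * q + cnj x * s) * z)
        ((z * cnj z + w * cnj w) * b)"
proof -
  define u v where "u = x * cnj x + y * cnj y" and "v = z * cnj z + w * cnj w"
  have "u = of_real ((cmod x)\<^sup>2 + (cmod y)\<^sup>2)" "v = of_real ((cmod z)\<^sup>2 + (cmod w)\<^sup>2)"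
    by (simp_all only: u_def v_def of_real_add complex_norm_square)
  moreover have "(cmod x)\<^sup>2 + (cmod y)\<^sup>2 \<noteq> 0" "(cmod z)\<^sup>2 + (cmod w)\<^sup>2 \<noteq> 0"
    using assms by (simp_all add: sum_power2_eq_zero_iff)
  ultimately have nz: "u \<noteq> 0" "v \<noteq> 0" by (simp_all only: of_real_eq_0_iff not_False_eq_True)
  have c: "cnj u = u" "cnj v = v" by (simp_all add: u_def v_def ac_simps)
  have "hmat x y 0 0 0 0 z w ** hmat (cnj x / u) (- y / u) 0 0 0 0 (cnj z / v) (- w / v) = mat 1"
    unfolding vec_eq_iff forall_4 hmat_mult_nth sum_4 mat_one_nth
    using nz by (simp add: hmat_nth c field_simps) (simp add: u_def v_def algebra_simps)
  then show "hmat x y 0 0 0 0 z w \<in> carrier GL2H" by (rule hmat_in_GL2H)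
  show "ext2_act (hmat x y 0 0 0 0 z w) (biherm a p q r s b) =
      biherm ((x * cnj x + y * cnj y) * a)
        ((x * p - cnj y * r) * cnj z - (x * q - cnj y * s) * w)
        ((x * p - cnj y * r) * cnj w + (x * q - cnj y * s) * z)
        ((y * p + cnj x * r) * cnj z - (y * q + cnj x * s) * w)
        ((y * p + cnj x * r) * cnj w + (y * q + cnj x * s) * z)
        ((z * cnj z + w * cnj w) * b)"
    by (rule ext2_eqI) (simp_all add: ext2_act_in_ext2 biherm_in_ext2 act_nth sum_4 biherm_nth hmat_nth algebra_simps)
qed

text \<open>The unipotent matrix with lower left block \<open>C\<close> acts by
\<open>(a, P, b) \<mapsto> (a, P + a C\<^sup>*, b + tr (C P) + a |C|\<^sup>2)\<close>: it completes squares when \<open>a \<noteq> 0\<close>, and it shifts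
\<open>b\<close> alone when \<open>a = 0\<close>.\<close>

lemma lower_move:
  shows "hmat 1 0 0 0 z w 1 0 \<in> carrier GL2H"
    and "ext2_act (hmat 1 0 0 0 z w 1 0) (biherm a p q r s b) =
      biherm a (p + a * cnj z) (q + a * cnj w) (r - a * w) (s + a * z)
        (b + z * p - cnj w * r + w * q + cnj z * s + a * (z * cnj z + w * cnj w))"
proof -
  have "hmat 1 0 0 0 z w 1 0 ** hmat 1 0 0 0 (-z) (-w) 1 0 = mat 1"
    unfolding vec_eq_iff forall_4 hmat_mult_nth sum_4 mat_one_nth
    by (simp add: hmat_nth)
  then show "hmat 1 0 0 0 z w 1 0 \<in> carrier GL2H" by (rule hmat_in_GL2H)
  show "ext2_act (hmat 1 0 0 0 z w 1 0) (biherm a p q r s b) =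
      biherm a (p + a * cnj z) (q + a * cnj w) (r - a * w) (s + a * z)
        (b + z * p - cnj w * r + w * q + cnj z * s + a * (z * cnj z + w * cnj w))"
    by (rule ext2_eqI) (simp_all add: ext2_act_in_ext2 biherm_in_ext2 act_nth sum_4 biherm_nth hmat_nth algebra_simps)
qed

text \<open>Exchanging the two quaternionic coordinates replaces \<open>P\<close> by the adjugate of \<open>P\<close>, the complexified
quaternionic conjugate.\<close>

lemma swap_move:
  shows "hmat 0 0 1 0 1 0 0 0 \<in> carrier GL2H"
    and "ext2_act (hmat 0 0 1 0 1 0 0 0) (biherm a p q r s b) = biherm b s (- q) (- r) p a"
proof -
  have "hmat 0 0 1 0 1 0 0 0 ** hmat 0 0 1 0 1 0 0 0 = mat 1"
    unfolding vec_eq_iff forall_4 hmat_mult_nth sum_4 mat_one_nth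
    by (simp add: hmat_nth)
  then show "hmat 0 0 1 0 1 0 0 0 \<in> carrier GL2H" by (rule hmat_in_GL2H)
  show "ext2_act (hmat 0 0 1 0 1 0 0 0) (biherm a p q r s b) = biherm b s (- q) (- r) p a"
    by (rule ext2_eqI) (simp_all add: ext2_act_in_ext2 biherm_in_ext2 act_nth sum_4 biherm_nth hmat_nth algebra_simps)
qed

text \<open>The vectors \<open>(1, 1)\<close> and \<open>(1, -1)\<close> diagonalise every matrix \<open>[[a, p], [p, a]]\<close>; they are real, so this
works for complex \<open>a\<close> and \<open>p\<close> simultaneously.\<close>

lemma hadamard_move:
  shows "hmat 1 0 1 0 (-1) 0 1 0 \<in> carrier GL2H"
    and "ext2_act (hmat 1 0 1 0 (-1) 0 1 0) (biherm a p 0 0 p a) = biherm (2 * a + 2 * p) 0 0 0 0 (2 * a - 2 * p)"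
proof -
  have "hmat 1 0 1 0 (-1) 0 1 0 ** hmat (1/2) 0 (-1/2) 0 (1/2) 0 (1/2) 0 = mat 1"
    unfolding vec_eq_iff forall_4 hmat_mult_nth sum_4 mat_one_nth
    by (simp add: hmat_nth)
  then show "hmat 1 0 1 0 (-1) 0 1 0 \<in> carrier GL2H" by (rule hmat_in_GL2H)
  show "ext2_act (hmat 1 0 1 0 (-1) 0 1 0) (biherm a p 0 0 p a) = biherm (2 * a + 2 * p) 0 0 0 0 (2 * a - 2 * p)"
    by (rule ext2_eqI) (simp_all add: ext2_act_in_ext2 biherm_in_ext2 act_nth sum_4 biherm_nth hmat_nth algebra_simps)
qed

text \<open>Relates two pictures of a negative definite plane: inside the off-diagonal quaternions, and spanned by
a diagonal and an off-diagonal matrix as in the list.\<close>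

lemma cayley_move:
  shows "hmat 1 0 \<i> 0 \<i> 0 1 0 \<in> carrier GL2H"
    and "ext2_act (hmat 1 0 \<i> 0 \<i> 0 1 0) (biherm 0 p 0 0 s 0) =
     biherm (\<i> * (s - p)) (p + s) 0 0 (p + s) (\<i> * (p - s))"
proof -
  have "hmat 1 0 \<i> 0 \<i> 0 1 0 ** hmat (1/2) 0 (-\<i>/2) 0 (-\<i>/2) 0 (1/2) 0 = mat 1"
    unfolding vec_eq_iff forall_4 hmat_mult_nth sum_4 mat_one_nth
    by (simp add: hmat_nth)
  then show "hmat 1 0 \<i> 0 \<i> 0 1 0 \<in> carrier GL2H" by (rule hmat_in_GL2H)
  show "ext2_act (hmat 1 0 \<i> 0 \<i> 0 1 0) (biherm 0 p 0 0 s 0) =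
     biherm (\<i> * (s - p)) (p + s) 0 0 (p + s) (\<i> * (p - s))"
    by (rule ext2_eqI) (simp_all add: ext2_act_in_ext2 biherm_in_ext2 act_nth sum_4 biherm_nth hmat_nth algebra_simps)
qed

section \<open>Orbits in terms of representing matrices\<close>

definition proj_equiv :: "complex^4^4 \<Rightarrow> complex^4^4 \<Rightarrow> bool" (infix "\<approx>\<^sub>H" 50) where
  "M \<approx>\<^sub>H N \<longleftrightarrow> (\<exists>T\<in>carrier GL2H. \<exists>c. c \<noteq> 0 \<and> ext2_act T M = cscale c N)"

lemma cscale_cscale: "cscale a (cscale b M) = cscale (a * b) M"
  by (simp add: cscale_def vec_eq_iff)

lemma cscale_one: "cscale 1 M = M"
  by (simp add: cscale_def vec_eq_iff)

lemma cline_eq_iff: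
  assumes "M \<noteq> 0"
  shows "cline M = cline N \<longleftrightarrow> (\<exists>c. c \<noteq> 0 \<and> M = cscale c N)"
proof
  assume "cline M = cline N"
  moreover have "M \<in> cline M" unfolding cline_def using cscale_one[of M, symmetric] by blast
  ultimately obtain c where "M = cscale c N" unfolding cline_def by blast
  moreover from this assms have "c \<noteq> 0" by (auto simp: cscale_def vec_eq_iff)
  ultimately show "\<exists>c. c \<noteq> 0 \<and> M = cscale c N" by blast
next
  assume "\<exists>c. c \<noteq> 0 \<and> M = cscale c N"
  then obtain c where c: "c \<noteq> 0" "M = cscale c N" by blast
  have "cscale d M = cscale (d * c) N" "cscale d N = cscale (d / c) M" for d
    using c by (simp_all add: cscale_cscale)
  then show "cline M = cline N" unfolding cline_def by blast
qed

lemma orbit_cline: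
  assumes "M \<in> ext2" "M \<noteq> 0"
  shows "orbit PGL2H proj_act (cline M) = {cline (ext2_act T M) | T. T \<in> carrier GL2H}"
proof -
  have "carrier PGL2H = (\<lambda>T. real_scalars #>\<^bsub>GL2H\<^esub> T) ` carrier GL2H"
    unfolding PGL2H_def by (simp add: carrier_FactGroup)
  then show ?thesis
    by (auto simp: orbit_def Setcompr_eq_image image_image proj_act_coset[OF _ assms])
qed

text \<open>From here on no cosets and no lines are needed: orbits of points become classes of nonzero matrices.\<close>

lemma orbit_eq_iff:
  assumes M: "M \<in> ext2" "M \<noteq> 0" and N: "N \<in> ext2" "N \<noteq> 0"
  shows "orbit PGL2H proj_act (cline M) = orbit PGL2H proj_act (cline N) \<longleftrightarrow> M \<approx>\<^sub>H N"
proof -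
  interpret group_action PGL2H proj_ext2 proj_act by (rule group_action_proj_act)
  have mem: "cline M \<in> proj_ext2" "cline N \<in> proj_ext2"
    using M N unfolding proj_ext2_def by blast+
  have "cline N \<in> orbit PGL2H proj_act (cline M) \<longleftrightarrow>
      (\<exists>T\<in>carrier GL2H. cline (ext2_act T M) = cline N)"
    unfolding orbit_cline[OF M] by blast
  also have "\<dots> \<longleftrightarrow> M \<approx>\<^sub>H N"
    unfolding proj_equiv_def using cline_eq_iff[OF ext2_act_nonzero[OF _ M(2)]] by simp
  finally have "cline N \<in> orbit PGL2H proj_act (cline M) \<longleftrightarrow> M \<approx>\<^sub>H N" .
  moreover have "orbit PGL2H proj_act (cline M) = orbit PGL2H proj_act (cline N)"
    if N': "cline N \<in> orbit PGL2H proj_act (cline M)"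
  proof -
    have M': "cline M \<in> orbit PGL2H proj_act (cline N)" by (rule orbit_sym[OF mem N'])
    have sub: "r \<in> proj_ext2" if "r \<in> orbit PGL2H proj_act p" "p \<in> proj_ext2" for p r
      using that element_image unfolding orbit_def by blast
    show ?thesis
    proof (intro equalityI subsetI)
      fix r assume r: "r \<in> orbit PGL2H proj_act (cline M)"
      show "r \<in> orbit PGL2H proj_act (cline N)"
        by (rule orbit_trans[OF mem(2) mem(1) sub[OF r mem(1)] M' r])
    next
      fix r assume r: "r \<in> orbit PGL2H proj_act (cline N)"
      show "r \<in> orbit PGL2H proj_act (cline M)"
        by (rule orbit_trans[OF mem(1) mem(2) sub[OF r mem(2)] N' r])
    qed
  qed
  moreover have "cline N \<in> orbit PGL2H proj_act (cline N)" by (rule orbit_refl[OF mem(2)])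
  ultimately show ?thesis by (metis (no_types))
qed

lemma proj_equiv_trans [trans]:
  assumes "L \<approx>\<^sub>H M" "M \<approx>\<^sub>H N"
  shows "L \<approx>\<^sub>H N"
proof -
  interpret group GL2H by (rule group_GL2H)
  obtain S c T d where S: "S \<in> carrier GL2H" "c \<noteq> 0" "ext2_act S L = cscale c M"
    and T: "T \<in> carrier GL2H" "d \<noteq> 0" "ext2_act T M = cscale d N"
    using assms unfolding proj_equiv_def by blast
  have "ext2_act (T ** S) L = cscale (c * d) N"
    by (simp add: ext2_act_mult S T ext2_act_cscale cscale_cscale)
  moreover have "T ** S \<in> carrier GL2H" using m_closed[OF T(1) S(1)] by (simp only: GL2H_mult)
  ultimately show ?thesis unfolding proj_equiv_def using S(2) T(2) by (metis no_zero_divisors)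
qed

lemma proj_equiv_act: "T \<in> carrier GL2H \<Longrightarrow> M \<approx>\<^sub>H ext2_act T M"
  unfolding proj_equiv_def using cscale_one[of "ext2_act T M"] by (metis zero_neq_one)

lemma proj_equiv_cscale:
  assumes "c \<noteq> 0"
  shows "M \<approx>\<^sub>H cscale c M"
proof -
  interpret group GL2H by (rule group_GL2H)
  have "mat 1 \<in> carrier GL2H" using one_closed by (simp only: GL2H_one)
  moreover have "M = cscale (1 / c) (cscale c M)" "1 / c \<noteq> 0"
    using assms by (simp_all add: cscale_cscale cscale_one)
  ultimately show ?thesis unfolding proj_equiv_def using ext2_act_one by metis
qed

section \<open>Invariants of an orbit\<close>

definition pfaffian :: "complex^4^4 \<Rightarrow> complex" where
  "pfaffian M = M$1$2 * M$3$4 - M$1$3 * M$2$4 + M$1$4 * M$2$3"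

text \<open>The real structure \<open>u \<and> v \<mapsto> J u \<and> J v\<close> of the exterior square; its fixed vectors form the real
six-space on which the Pfaffian has signature \<open>(1, 5)\<close>.\<close>

definition conjJ :: "complex^4^4 \<Rightarrow> complex^4^4" where
  "conjJ M = ext2_act quatJ (map_matrix cnj M)"

text \<open>The polar form of the Pfaffian at \<open>M\<close> and \<open>conjJ M\<close>.  For \<open>M = x + \<i> y\<close> with \<open>x\<close>, \<open>y\<close> real it equals
\<open>2 (pfaffian x + pfaffian y)\<close>.\<close>

definition hform :: "complex^4^4 \<Rightarrow> complex" where
  "hform M = pfaffian (M + conjJ M) - pfaffian M - pfaffian (conjJ M)"

text \<open>The line of \<open>M\<close> is stable under the real structure, that is, some nonzero multiple of \<open>M\<close> is real
(or \<open>M = 0\<close>).\<close>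

definition real_point :: "complex^4^4 \<Rightarrow> bool" where
  "real_point M \<longleftrightarrow> (\<exists>u. conjJ M = cscale u M)"

lemma conjJ_act:
  assumes "T \<in> carrier GL2H"
  shows "conjJ (ext2_act T M) = ext2_act T (conjJ M)"
proof -
  have T: "T ** quatJ = quatJ ** map_matrix cnj T" using assms by (simp add: carrier_GL2H)
  have "map_matrix cnj (ext2_act T M) = ext2_act (map_matrix cnj T) (map_matrix cnj M)"
  proof -
    have "map_matrix cnj (transpose T) = transpose (map_matrix cnj T)"
      by (simp add: transpose_def vec_eq_iff)
    then show ?thesis by (simp add: ext2_act_def map_matrix_cnj_mult)
  qed
  then show ?thesis unfolding conjJ_def by (simp flip: ext2_act_mult add: T)
qed

lemma quatJ_hmat: "quatJ = hmat 0 1 0 0 0 0 0 1"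
  unfolding vec_eq_iff forall_4 by (simp add: hmat_nth) (simp add: quatJ_def block_nth)

lemma conjJ_biherm: "conjJ (biherm a p q r s b) = biherm (cnj a) (cnj s) (- cnj r) (- cnj q) (cnj p) (cnj b)"
proof (rule ext2_eqI)
  have "map_matrix cnj (biherm a p q r s b) = biherm (cnj a) (cnj p) (cnj q) (cnj r) (cnj s) (cnj b)"
    unfolding vec_eq_iff forall_4 by (simp add: biherm_nth)
  then have *: "conjJ (biherm a p q r s b) = ext2_act quatJ (biherm (cnj a) (cnj p) (cnj q) (cnj r) (cnj s) (cnj b))"
    by (simp add: conjJ_def)
  show "conjJ (biherm a p q r s b) \<in> ext2" unfolding * by (simp add: ext2_act_in_ext2 biherm_in_ext2)
qed (simp_all add: biherm_in_ext2 conjJ_def act_nth sum_4 biherm_nth quatJ_hmat hmat_nth)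

lemma biherm_add:
  "biherm a p q r s b + biherm a' p' q' r' s' b' =
     biherm (a+a') (p+p') (q+q') (r+r') (s+s') (b+b')"
  by (rule ext2_eqI) (simp_all add: ext2_add biherm_in_ext2 biherm_nth)

lemma pfaffian_biherm: "pfaffian (biherm a p q r s b) = a * b - (p * s - q * r)"
  by (simp add: pfaffian_def biherm_nth)

lemma hform_biherm: "hform (biherm a p q r s b) =
  of_real (2 * Re (a * cnj b) - (cmod p)\<^sup>2 - (cmod q)\<^sup>2 - (cmod r)\<^sup>2 - (cmod s)\<^sup>2)"
proof -
  have "of_real (2 * Re (a * cnj b)) = a * cnj b + cnj a * b"
    using complex_add_cnj[of "a * cnj b"] by simp
  then show ?thesis
    unfolding hform_def conjJ_biherm biherm_add pfaffian_biherm of_real_diff complex_norm_square by algebra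
qed

text \<open>The factor by which \<open>T\<close> scales the Pfaffian, read off from one matrix of Pfaffian \<open>1\<close>; it is the
determinant of \<open>T\<close>.  In this form it is given by the two quaternionic rows of \<open>T\<close>, and its
positivity is the Cauchy-Schwarz inequality between them.\<close>

definition multiplier :: "complex^4^4 \<Rightarrow> complex" where
  "multiplier T = pfaffian (ext2_act T (biherm 1 0 0 0 0 1))"

lemma pfaffian_act:
  assumes "M \<in> ext2"
  shows "pfaffian (ext2_act T M) = multiplier T * pfaffian M"
proof -
  obtain a p q r s b where M: "M = biherm a p q r s b" using ext2_biherm[OF assms] by blast
  show ?thesis unfolding M multiplier_def pfaffian_biherm
    unfolding pfaffian_def act_nth sum_4 biherm_nth mult_zero_left mult_zero_right add_0_left add_0_right
      mult_1_right mult_minus_right minus_zero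
    by algebra
qed

lemma multiplier_mult: "multiplier (S ** T) = multiplier S * multiplier T"
  using pfaffian_act[OF ext2_act_in_ext2[OF biherm_in_ext2], of S T 1 0 0 0 0 1]
  by (simp add: multiplier_def ext2_act_mult)

text \<open>With the quaternionic rows \<open>(A, B)\<close> and \<open>(C, D)\<close> of the matrix, this is the Gram determinant
\<open>(|A|\<^sup>2 + |B|\<^sup>2) (|C|\<^sup>2 + |D|\<^sup>2) - |A C\<^sup>* + B D\<^sup>*|\<^sup>2\<close>.\<close>

lemma multiplier_hmat: "multiplier (hmat a a' b b' c c' d d') =
   of_real (((cmod a)\<^sup>2+(cmod a')\<^sup>2+(cmod b)\<^sup>2+(cmod b')\<^sup>2)
      * ((cmod c)\<^sup>2+(cmod c')\<^sup>2+(cmod d)\<^sup>2+(cmod d')\<^sup>2)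
    - (cmod (cnj c * a + c' * cnj a' + cnj d * b + d' * cnj b'))\<^sup>2
    - (cmod (c' * cnj a - cnj c * a' + d' * cnj b - cnj d * b'))\<^sup>2)"
  unfolding multiplier_def pfaffian_def act_nth sum_4 biherm_nth hmat_nth
    of_real_diff of_real_mult of_real_add complex_norm_square
    complex_cnj_add complex_cnj_diff complex_cnj_mult complex_cnj_cnj mult_zero_left mult_zero_right
    add_0_left add_0_right mult_1_right mult_minus_right minus_zero
  by algebra

text \<open>The sign of \<open>hform\<close> is an invariant only because the multiplier is positive.  It is nonzero by
multiplicativity.  If \<open>A = 0\<close> it is \<open>|B|\<^sup>2 |C|\<^sup>2\<close>; otherwise a Schur complement shows that \<open>|A|\<^sup>2\<close> times
it is the square norm of \<open>|A|\<^sup>2 D - C A\<^sup>* B\<close>.\<close>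

lemma multiplier_pos:
  assumes "T \<in> carrier GL2H"
  shows "\<exists>r>0. multiplier T = of_real r"
proof -
  have "\<exists>a a' b b' c c' d d'. T = hmat a a' b b' c c' d d'"
    using assms unfolding GL2H_def rhoH_def hmat_def qmat_def by (simp only: partial_object.simps mem_Collect_eq) blast
  then obtain a a' b b' c c' d d' where T: "T = hmat a a' b b' c c' d d'" by blast
  define r where "r = ((cmod a)\<^sup>2+(cmod a')\<^sup>2+(cmod b)\<^sup>2+(cmod b')\<^sup>2)
      * ((cmod c)\<^sup>2+(cmod c')\<^sup>2+(cmod d)\<^sup>2+(cmod d')\<^sup>2)
    - (cmod (cnj c * a + c' * cnj a' + cnj d * b + d' * cnj b'))\<^sup>2
    - (cmod (c' * cnj a - cnj c * a' + d' * cnj b - cnj d * b'))\<^sup>2"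
  have multiplier: "multiplier T = of_real r" unfolding T r_def by (rule multiplier_hmat)
  obtain S where "T ** S = mat 1" using assms by (auto simp: carrier_GL2H invertible_def)
  then have "multiplier T * multiplier S = 1"
    using multiplier_mult[of T S] by (simp add: multiplier_def ext2_act_one pfaffian_biherm)
  then have "r \<noteq> 0" using multiplier by auto
  moreover have "r \<ge> 0"
  proof (cases "a = 0 \<and> a' = 0")
    case True
    have "complex_of_real r = of_real (((cmod b)\<^sup>2+(cmod b')\<^sup>2) * ((cmod c)\<^sup>2+(cmod c')\<^sup>2))"
      unfolding r_def of_real_diff of_real_mult of_real_add complex_norm_square
        complex_cnj_add complex_cnj_diff complex_cnj_mult complex_cnj_cnj True[THEN conjunct1] True[THEN conjunct2]
        complex_cnj_zero
      by algebra
    then have "r = ((cmod b)\<^sup>2+(cmod b')\<^sup>2) * ((cmod c)\<^sup>2+(cmod c')\<^sup>2)" by (simp only: of_real_eq_iff)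
    then show ?thesis by simp
  next
    case False
    define u where "u = (cmod a)\<^sup>2 + (cmod a')\<^sup>2"
    have u: "u > 0" using False unfolding u_def by (simp add: sum_power2_gt_zero_iff)
    \<comment> \<open>The quaternion \<open>C A\<^sup>*\<close>.\<close>
    define e where "e = c * cnj a + cnj c' * a'"
    define e' where "e' = c' * cnj a - cnj c * a'"
    have "complex_of_real (u * r) = of_real ((cmod (of_real u * d - (e * b - cnj e' * b')))\<^sup>2
        + (cmod (of_real u * d' - (e' * b + cnj e * b')))\<^sup>2)"
      unfolding r_def e_def e'_def
      unfolding of_real_diff of_real_mult of_real_add complex_norm_square
        complex_cnj_add complex_cnj_diff complex_cnj_mult complex_cnj_cnj complex_cnj_complex_of_real
      unfolding u_def of_real_add complex_norm_square
      by algebra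
    then have "u * r = (cmod (of_real u * d - (e * b - cnj e' * b')))\<^sup>2
        + (cmod (of_real u * d' - (e' * b + cnj e * b')))\<^sup>2"
      by (simp only: of_real_eq_iff)
    then have "u * r \<ge> 0" by simp
    then show ?thesis using u by (simp add: zero_le_mult_iff)
  qed
  ultimately show ?thesis using multiplier by (intro exI[of _ r]) simp
qed

lemma conjJ_in_ext2: "M \<in> ext2 \<Longrightarrow> conjJ M \<in> ext2"
  using ext2_biherm[of M] conjJ_biherm biherm_in_ext2 by metis

lemma hform_act:
  assumes "T \<in> carrier GL2H" "M \<in> ext2"
  shows "hform (ext2_act T M) = multiplier T * hform M"
  using assms
  by (simp add: hform_def conjJ_act pfaffian_act ext2_add conjJ_in_ext2 algebra_simps flip: ext2_act_add)

lemma pfaffian_cscale: "pfaffian (cscale c M) = c\<^sup>2 * pfaffian M"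
  by (simp add: pfaffian_def cscale_def algebra_simps power2_eq_square)

lemma hform_cscale:
  assumes "M \<in> ext2"
  shows "hform (cscale c M) = of_real ((cmod c)\<^sup>2) * hform M"
proof -
  obtain a p q r s b where M: "M = biherm a p q r s b" using ext2_biherm[OF assms] by blast
  have "2 * Re (c * a * cnj (c * b)) = (cmod c)\<^sup>2 * (2 * Re (a * cnj b))"
    unfolding cmod_power2 by (simp add: power2_eq_square algebra_simps)
  then show ?thesis
    unfolding M cscale_biherm hform_biherm of_real_mult[symmetric] of_real_eq_iff
    by (simp only: norm_mult power_mult_distrib right_diff_distrib flip: of_real_mult)
qed

lemma conjJ_cscale: "conjJ (cscale c M) = cscale (cnj c) (conjJ M)"
proof -
  have "map_matrix cnj (cscale c M) = cscale (cnj c) (map_matrix cnj M)"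
    by (simp add: cscale_def vec_eq_iff)
  then show ?thesis by (simp add: conjJ_def ext2_act_cscale)
qed

lemma real_point_cscale:
  assumes "c \<noteq> 0" "real_point (cscale c M)"
  shows "real_point M"
proof -
  obtain u where u: "cscale (cnj c) (conjJ M) = cscale (u * c) M"
    using assms(2) by (auto simp: real_point_def conjJ_cscale cscale_cscale)
  have "conjJ M = cscale (1 / cnj c) (cscale (cnj c) (conjJ M))"
    using assms(1) by (simp add: cscale_cscale cscale_one)
  then show ?thesis unfolding u cscale_cscale real_point_def by blast
qed

lemma real_point_act:
  assumes "T \<in> carrier GL2H" "real_point M"
  shows "real_point (ext2_act T M)"
  using assms by (auto simp: real_point_def conjJ_act ext2_act_cscale)

lemma real_point_biherm: "real_point (biherm a p q r s b) \<longleftrightarrow>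
   (\<exists>u. cnj a = u * a \<and> cnj s = u * p \<and> - cnj r = u * q \<and> - cnj q = u * r \<and> cnj p = u * s \<and> cnj b = u * b)"
  unfolding real_point_def conjJ_biherm cscale_biherm biherm_eq_iff ..

text \<open>Passing to the quotient removes both the multiplier and the choice of a vector on the line.  The ratio
is \<open>0\<close> on the isotropic points, where the Pfaffian vanishes.\<close>

definition ratio :: "complex^4^4 \<Rightarrow> real" where
  "ratio M = Re (hform M) / cmod (pfaffian M)"

lemma ratio_cscale:
  assumes "M \<in> ext2" "c \<noteq> 0"
  shows "ratio (cscale c M) = ratio M"
  unfolding ratio_def hform_cscale[OF assms(1)] pfaffian_cscale
  using assms(2) by (simp add: norm_mult norm_power)

lemma invariants_equiv:
  assumes eq: "M \<approx>\<^sub>H N" and M: "M \<in> ext2" and N: "N \<in> ext2"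
  shows "pfaffian M = 0 \<longleftrightarrow> pfaffian N = 0" "hform M = 0 \<longleftrightarrow> hform N = 0" "ratio M = ratio N"
    and "real_point M \<Longrightarrow> real_point N"
proof -
  obtain T c where T: "T \<in> carrier GL2H" "c \<noteq> 0" "ext2_act T M = cscale c N"
    using eq unfolding proj_equiv_def by blast
  obtain r where r: "r > 0" "multiplier T = of_real r" using multiplier_pos[OF T(1)] by blast
  have pfaffian: "of_real r * pfaffian M = c\<^sup>2 * pfaffian N"
    using pfaffian_act[OF M, of T] unfolding T(3) pfaffian_cscale r(2) by simp
  have he: "of_real r * hform M = of_real ((cmod c)\<^sup>2) * hform N"
    using hform_act[OF T(1) M] unfolding T(3) hform_cscale[OF N] r(2) by simp
  show "pfaffian M = 0 \<longleftrightarrow> pfaffian N = 0" using pfaffian r(1) T(2) by auto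
  show "hform M = 0 \<longleftrightarrow> hform N = 0" using he r(1) T(2) by auto
  have "ratio M = ratio (ext2_act T M)"
    unfolding ratio_def hform_act[OF T(1) M] pfaffian_act[OF M] r(2)
    using r(1) by (simp add: norm_mult)
  then show "ratio M = ratio N" unfolding T(3) by (simp add: ratio_cscale N T(2))
  show "real_point N" if "real_point M"
    using real_point_act[OF T(1) that] real_point_cscale[OF T(2)] unfolding T(3) by blast
qed

section \<open>Reduction to the list\<close>

fun rep_mat :: "orbit_type \<Rightarrow> complex^4^4" where
  "rep_mat RealNull = biherm 1 0 0 0 0 0"
| "rep_mat NonrealIsotropic = biherm 1 \<i> 0 0 \<i> (-1)"
| "rep_mat RealTimelike = biherm 1 0 0 0 0 1"
| "rep_mat RealSpacelike = biherm (-1) 0 0 0 0 1"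
| "rep_mat NonrealDegenerate = biherm 1 \<i> 0 0 \<i> 0"
| "rep_mat (NonrealLorentzian \<theta>) = biherm 1 0 0 0 0 (exp (\<i> * of_real \<theta>))"
| "rep_mat (NonrealNegdef l) = biherm (-1) (\<i> * of_real l) 0 0 (\<i> * of_real l) 1"

lemma representative_rep_mat: "representative t = cline (rep_mat t)"
  by (cases t) (simp_all add: hpoint_def biherm_def)

lemma rep_mat_nonzero: "rep_mat t \<noteq> 0"
  by (cases t) (simp_all add: biherm_zero_iff)

lemma rep_mat_in_ext2: "rep_mat t \<in> ext2"
  by (cases t) (simp_all add: biherm_in_ext2)

definition classified :: "complex^4^4 \<Rightarrow> bool" where
  "classified M \<longleftrightarrow> (\<exists>t\<in>orbit_types. M \<approx>\<^sub>H rep_mat t)"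

lemma classified_trans: "M \<approx>\<^sub>H N \<Longrightarrow> classified N \<Longrightarrow> classified M"
  unfolding classified_def using proj_equiv_trans by blast

lemma classified_act: "T \<in> carrier GL2H \<Longrightarrow> classified (ext2_act T M) \<Longrightarrow> classified M"
  using classified_trans[OF proj_equiv_act] .

lemma classified_cscale:
  assumes "c \<noteq> 0" "classified (biherm (c * a) (c * p) (c * q) (c * r) (c * s) (c * b))"
  shows "classified (biherm a p q r s b)"
  using classified_trans[OF proj_equiv_cscale[OF assms(1)], of "biherm a p q r s b"] assms(2)
  by (simp add: cscale_biherm)

lemma classified_rep_mat: "t \<in> orbit_types \<Longrightarrow> classified (rep_mat t)"
  unfolding classified_def using proj_equiv_cscale[of 1 "rep_mat t"] by (auto simp: cscale_one)

lemma classified_diag: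
  assumes "(x, y) \<noteq> (0, 0)" "(z, w) \<noteq> (0, 0)"
    and "classified (biherm ((x * cnj x + y * cnj y) * a)
        ((x * p - cnj y * r) * cnj z - (x * q - cnj y * s) * w)
        ((x * p - cnj y * r) * cnj w + (x * q - cnj y * s) * z)
        ((y * p + cnj x * r) * cnj z - (y * q + cnj x * s) * w)
        ((y * p + cnj x * r) * cnj w + (y * q + cnj x * s) * z)
        ((z * cnj z + w * cnj w) * b))"
  shows "classified (biherm a p q r s b)"
  by (rule classified_act[OF diag_move(1)[OF assms(1,2)]]) (simp only: diag_move(2)[OF assms(1,2)] assms(3))

lemma classified_scale:
  assumes "u \<noteq> 0" "v \<noteq> 0"
    and "classified (biherm (of_real (u^2) * a) (of_real (u * v) * p) (of_real (u * v) * q)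
       (of_real (u * v) * r) (of_real (u * v) * s) (of_real (v^2) * b))"
  shows "classified (biherm a p q r s b)"
  by (rule classified_diag[of "of_real u" 0 "of_real v" 0])
    (use assms in \<open>simp_all add: power2_eq_square ac_simps\<close>)

lemma classified_lower:
  assumes "classified (biherm a (p + a * cnj z) (q + a * cnj w) (r - a * w) (s + a * z)
        (b + z * p - cnj w * r + w * q + cnj z * s + a * (z * cnj z + w * cnj w)))"
  shows "classified (biherm a p q r s b)"
  by (rule classified_act[OF lower_move(1)[of z w]]) (simp only: lower_move(2) assms)

lemma classified_swap:
  assumes "classified (biherm b s (- q) (- r) p a)"
  shows "classified (biherm a p q r s b)"
  by (rule classified_act[OF swap_move(1)]) (simp only: swap_move(2) assms)

text \<open>The \<open>NonrealNegdef\<close> family continued to \<open>-1 \<le> l \<le> 1\<close>: it is symmetric in \<open>l\<close>, its centre is the real space-like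
point and its ends are the non-real isotropic point.\<close>

lemma classified_negdef:
  assumes "\<bar>l\<bar> \<le> 1"
  shows "classified (biherm (-1) (\<i> * of_real l) 0 0 (\<i> * of_real l) 1)"
proof -
  have pos: "classified (biherm (-1) (\<i> * of_real l) 0 0 (\<i> * of_real l) 1)" if l: "0 \<le> l" "l \<le> 1" for l
  proof -
    consider "l = 0" | "0 < l" "l < 1" | "l = 1" using l by linarith
    then show ?thesis
    proof cases
      case 1
      have "classified (rep_mat RealSpacelike)" by (rule classified_rep_mat) (simp add: orbit_types_def)
      then show ?thesis by (simp add: 1)
    next
      case 2
      have "classified (rep_mat (NonrealNegdef l))"
        by (rule classified_rep_mat) (use 2 in \<open>simp add: orbit_types_def\<close>)
      then show ?thesis by simp
    next
      case 3
      have "classified (rep_mat NonrealIsotropic)" by (rule classified_rep_mat) (simp add: orbit_types_def)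
      then have "classified (biherm 1 (-\<i>) 0 0 (-\<i>) (-1))"
        by (rule_tac classified_scale[of "-1" 1]) simp_all
      then show ?thesis by (rule_tac classified_cscale[of "-1"]) (simp_all add: 3)
    qed
  qed
  show ?thesis
  proof (cases "0 \<le> l")
    case True
    then show ?thesis using pos assms by simp
  next
    case False
    then have "classified (biherm (-1) (\<i> * of_real (- l)) 0 0 (\<i> * of_real (- l)) 1)"
      using pos assms by (simp only:)
    then show ?thesis by (rule_tac classified_scale[of "-1" 1 "-1"]) simp_all
  qed
qed

text \<open>For \<open>t\<close> in \<open>[-1, 1]\<close> these are the planes inside the off-diagonal quaternions, \<open>t\<close> being the ratio of the
two semi-axes.\<close>

lemma classified_off_diagonal:
  assumes "\<bar>t\<bar> \<le> 1"
  shows "classified (biherm 0 (1 + of_real t) 0 0 (1 - of_real t) 0)"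
proof -
  have "classified (biherm (-1) (\<i> * of_real (- t)) 0 0 (\<i> * of_real (- t)) 1)"
    using assms by (rule_tac classified_negdef) simp
  then have "classified (biherm 2 (2 * \<i> * of_real t) 0 0 (2 * \<i> * of_real t) (-2))"
    by (rule_tac classified_cscale[of "-1/2"]) simp_all
  moreover have "ext2_act (hmat 1 0 \<i> 0 \<i> 0 1 0) (biherm 0 (\<i> * (1 + of_real t)) 0 0 (- \<i> * (1 - of_real t)) 0)
      = biherm 2 (2 * \<i> * of_real t) 0 0 (2 * \<i> * of_real t) (-2)"
    unfolding cayley_move(2) by (simp add: algebra_simps)
  ultimately have "classified (biherm 0 (\<i> * (1 + of_real t)) 0 0 (- \<i> * (1 - of_real t)) 0)"
    by (rule_tac classified_act[OF cayley_move(1)]) (simp only:)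
  \<comment> \<open>Left multiplication by the quaternion \<open>qmat \<i> 0\<close> makes the longer axis orthogonal to the scalars.\<close>
  then show ?thesis
    by (rule_tac classified_diag[of \<i> 0 1 0]) simp_all
qed

text \<open>An upper unipotent changes \<open>a\<close> by \<open>2 \<alpha> - 2 \<i> t \<beta>\<close> with \<open>\<alpha>\<close>, \<open>\<beta>\<close> real, and fixes \<open>P\<close>.  For \<open>t \<noteq> 0\<close> this
removes \<open>a\<close>.  For \<open>t = 0\<close> only the real part of \<open>a\<close> can be removed; a nonzero imaginary part left over
gives the degenerate point.\<close>

lemma classified_bottom_zero_diagonal:
  assumes "\<bar>t\<bar> \<le> 1"
  shows "classified (biherm a (1 + of_real t) 0 0 (1 - of_real t) 0)"
proof -
  have upper: "classified (biherm a (1 + of_real t) 0 0 (1 - of_real t) 0)"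
    if "classified (biherm (a + 2 * of_real \<alpha> - 2 * \<i> * of_real (t * \<beta>))
          (1 + of_real t) 0 0 (1 - of_real t) 0)" for \<alpha> \<beta>
  proof -
    \<comment> \<open>The upper unipotent is a lower one conjugated by the swap.\<close>
    define z where "z = Complex \<alpha> \<beta>"
    have "z + cnj z = 2 * of_real \<alpha>" "cnj z - z = - 2 * \<i> * of_real \<beta>"
      by (simp_all add: z_def complex_eq_iff)
    moreover have "a + z * (1 - of_real t) + cnj z * (1 + of_real t)
        = a + (z + cnj z) + of_real t * (cnj z - z)"
      by (simp add: algebra_simps)
    ultimately have "a + z * (1 - of_real t) + cnj z * (1 + of_real t)
        = a + 2 * of_real \<alpha> - 2 * \<i> * of_real (t * \<beta>)"
      by (simp only: of_real_mult) simp
    then have "classified (biherm (a + z * (1 - of_real t) + cnj z * (1 + of_real t))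
        (1 + of_real t) 0 0 (1 - of_real t) 0)"
      using that by (simp only:)
    then have "classified (biherm 0 (1 - of_real t) 0 0 (1 + of_real t)
        (a + z * (1 - of_real t) + cnj z * (1 + of_real t)))"
      by (rule_tac classified_swap) simp
    then have "classified (biherm 0 (1 - of_real t) 0 0 (1 + of_real t) a)"
      by (rule_tac classified_lower[where z = z and w = 0]) simp
    then show ?thesis by (rule_tac classified_swap) simp
  qed
  show ?thesis
  proof (cases "t = 0")
    case False
    then have "a + 2 * of_real (- Re a / 2) - 2 * \<i> * of_real (t * (Im a / (2 * t))) = 0"
      by (simp add: complex_eq_iff)
    then show ?thesis
      using upper[of "- Re a / 2" "Im a / (2 * t)"] classified_off_diagonal[OF assms] by (simp only:)
  next
    case True
    define \<alpha> where "\<alpha> = Im a"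
    have a: "a + 2 * of_real (- Re a / 2) - 2 * \<i> * of_real (t * 0) = \<i> * of_real \<alpha>"
      by (simp add: complex_eq_iff \<alpha>_def)
    have deg: "classified (biherm 1 \<i> 0 0 \<i> 0)"
      using classified_rep_mat[of NonrealDegenerate] by (simp add: orbit_types_def)
    have "classified (biherm (\<i> * of_real \<alpha>) 1 0 0 1 0)"
    proof (cases \<alpha> "0::real" rule: linorder_cases)
      case equal
      then show ?thesis using classified_off_diagonal[of 0] by simp
    next
      case less
      have "classified (biherm (of_real (- \<alpha>)) \<i> 0 0 \<i> 0)"
        by (rule classified_scale[of "1 / sqrt (- \<alpha>)" "sqrt (- \<alpha>)"])
          (use less deg in \<open>simp_all add: power_divide flip: of_real_mult of_real_minus\<close>)
      then show ?thesis by (rule_tac classified_cscale[of \<i>]) simp_all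
    next
      case greater
      have "classified (biherm (of_real \<alpha>) (- \<i>) 0 0 (- \<i>) 0)"
        by (rule classified_scale[of "- 1 / sqrt \<alpha>" "sqrt \<alpha>"])
          (use greater deg in \<open>simp_all add: power_divide flip: of_real_mult\<close>)
      then show ?thesis by (rule_tac classified_cscale[of "-\<i>"]) simp_all
    qed
    then show ?thesis using upper[of "- Re a / 2" 0] unfolding a by (simp add: True)
  qed
qed

text \<open>If \<open>P\<close> is Hermitian as a complex matrix, simultaneous left and right multiplication by a quaternion
diagonalises it.  Its eigenvalues are \<open>u + t\<close> and \<open>u - t\<close> with \<open>t\<^sup>2 = h\<^sup>2 + |k|\<^sup>2\<close>, and \<open>(t + h, k)\<close> is a left
eigenvector for \<open>u + t\<close>, which gives the first row of the diagonalising quaternion.\<close>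

lemma classified_bottom_zero_hermitian:
  assumes "u > 0" "h\<^sup>2 + (cmod k)\<^sup>2 \<le> u\<^sup>2"
  shows "classified (biherm a (of_real (u + h)) k (cnj k) (of_real (u - h)) 0)"
proof -
  define t where "t = (if k = 0 then h else sqrt (h\<^sup>2 + (cmod k)\<^sup>2))"
  have t2: "t\<^sup>2 = h\<^sup>2 + (cmod k)\<^sup>2" by (simp add: t_def)
  then have "\<bar>t\<bar> \<le> u" using assms by (metis abs_le_square_iff abs_of_pos)
  then have tu: "\<bar>t / u\<bar> \<le> 1" using assms(1) by simp
  have diag: "classified (biherm a' (of_real (n * (u + t))) 0 0 (of_real (n * (u - t))) 0)" if "n > 0" for a' n
  proof (rule classified_cscale)
    show c: "complex_of_real (1 / (n * u)) \<noteq> 0" using that assms(1) by simp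
    have "complex_of_real (1 / (n * u)) * of_real (n * (u + t)) = of_real (1 + t / u)"
      "complex_of_real (1 / (n * u)) * of_real (n * (u - t)) = of_real (1 - t / u)"
      unfolding of_real_mult[symmetric] of_real_eq_iff
      using that assms(1) by (simp_all add: field_simps)
    then show "classified (biherm (complex_of_real (1 / (n * u)) * a') (complex_of_real (1 / (n * u)) * of_real (n * (u + t)))
     (complex_of_real (1 / (n * u)) * 0) (complex_of_real (1 / (n * u)) * 0)
     (complex_of_real (1 / (n * u)) * of_real (n * (u - t))) (complex_of_real (1 / (n * u)) * 0))"
      using classified_bottom_zero_diagonal[OF tu] by (simp only: of_real_add of_real_diff of_real_1 mult_zero_right)
  qed
  show ?thesis
  proof (cases "k = 0")
    case True
    then show ?thesis using diag[of 1] by (simp add: t_def)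
  next
    case False
    \<comment> \<open>The diagonalising quaternion has square norm \<open>n\<close>; it is nonzero because \<open>k \<noteq> 0\<close>.\<close>
    define x where "x = t + h"
    define n where "n = x\<^sup>2 + (cmod k)\<^sup>2"
    have n: "n > 0" using False unfolding n_def by (simp add: add_nonneg_pos)
    have K: "k * cnj k = of_real t * of_real t - of_real h * of_real h"
    proof -
      have "(cmod k)\<^sup>2 = t * t - h * h" using t2 by (simp add: power2_eq_square)
      then show ?thesis by (simp add: complex_norm_square[symmetric] del: of_real_power)
    qed
    have nn: "complex_of_real n = of_real x * of_real x + k * cnj k"
      by (simp only: n_def of_real_add complex_norm_square) (simp add: power2_eq_square)
    have X: "complex_of_real x = of_real t + of_real h" by (simp add: x_def)
    show ?thesis
    proof (rule classified_diag[of "of_real x" "- cnj k" "of_real x" "- cnj k"])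
      have "(of_real x * of_real (u + h) - cnj (- cnj k) * cnj k) * cnj (of_real x)
          - (of_real x * k - cnj (- cnj k) * of_real (u - h)) * - cnj k = of_real (n * (u + t))"
        unfolding of_real_mult nn complex_cnj_complex_of_real complex_cnj_minus complex_cnj_cnj of_real_add of_real_diff
        using K X by algebra
      moreover have "(of_real x * of_real (u + h) - cnj (- cnj k) * cnj k) * cnj (- cnj k)
          + (of_real x * k - cnj (- cnj k) * of_real (u - h)) * of_real x = 0"
        unfolding of_real_mult nn complex_cnj_complex_of_real complex_cnj_minus complex_cnj_cnj of_real_add of_real_diff
        using K X by algebra
      moreover have "(- cnj k * of_real (u + h) + cnj (of_real x) * cnj k) * cnj (of_real x)
          - (- cnj k * k + cnj (of_real x) * of_real (u - h)) * - cnj k = 0"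
        unfolding of_real_mult nn complex_cnj_complex_of_real complex_cnj_minus complex_cnj_cnj of_real_add of_real_diff
        using K X by algebra
      moreover have "(- cnj k * of_real (u + h) + cnj (of_real x) * cnj k) * cnj (- cnj k)
          + (- cnj k * k + cnj (of_real x) * of_real (u - h)) * of_real x = of_real (n * (u - t))"
        unfolding of_real_mult nn complex_cnj_complex_of_real complex_cnj_minus complex_cnj_cnj of_real_add of_real_diff
        using K X by algebra
      ultimately show "classified (biherm ((of_real x * cnj (of_real x) + - cnj k * cnj (- cnj k)) * a)
        ((of_real x * of_real (u + h) - cnj (- cnj k) * cnj k) * cnj (of_real x)
          - (of_real x * k - cnj (- cnj k) * of_real (u - h)) * - cnj k)
        ((of_real x * of_real (u + h) - cnj (- cnj k) * cnj k) * cnj (- cnj k)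
          + (of_real x * k - cnj (- cnj k) * of_real (u - h)) * of_real x)
        ((- cnj k * of_real (u + h) + cnj (of_real x) * cnj k) * cnj (of_real x)
          - (- cnj k * k + cnj (of_real x) * of_real (u - h)) * - cnj k)
        ((- cnj k * of_real (u + h) + cnj (of_real x) * cnj k) * cnj (- cnj k)
          + (- cnj k * k + cnj (of_real x) * of_real (u - h)) * of_real x)
        ((of_real x * cnj (of_real x) + - cnj k * cnj (- cnj k)) * 0))"
        using diag[OF n] by (simp only: mult_zero_right)
    qed (use False in auto)
  qed
qed

text \<open>The condition \<open>b = 0\<close> means orthogonality to the real null vector \<open>biherm 1 0 0 0 0 0\<close>.  If \<open>P = 0\<close>, the point is real
and null.  Otherwise scaling makes \<open>\<delta> = det P\<close> equal to \<open>0\<close> or \<open>1\<close>.  Multiplying \<open>P\<close> on the left by the conjugate of its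
real part turns it into \<open>(P\<^sup>* P + \<delta>) / 2\<close>, because that conjugate is \<open>(P\<^sup>* + adj P) / 2\<close>.  This
matrix is Hermitian with positive trace and nonnegative determinant.\<close>

lemma classified_bottom_zero:
  assumes "biherm a p q r s 0 \<noteq> 0"
  shows "classified (biherm a p q r s 0)"
proof -
  have real_det: "classified (biherm a p q r s 0)"
    if det: "p * s - q * r = of_real \<delta>" "\<delta> \<ge> 0" and nz: "(p, q, r, s) \<noteq> (0, 0, 0, 0)" for a p q r s \<delta>
  proof -
    \<comment> \<open>The first column of \<open>(P\<^sup>* + adj P) / 2\<close>.\<close>
    define x y where "x = (cnj p + s) / 2" and "y = (cnj q - r) / 2"
    define P1 S1 where "P1 = ((cmod p)\<^sup>2 + (cmod r)\<^sup>2 + \<delta>) / 2" and "S1 = ((cmod q)\<^sup>2 + (cmod s)\<^sup>2 + \<delta>) / 2"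
    define k where "k = x * q - cnj y * s"
    have P1: "x * p - cnj y * r = of_real P1"
    proof -
      have "2 * (x * p - cnj y * r) = p * cnj p + r * cnj r + (p * s - q * r)"
        by (simp add: x_def y_def field_simps)
      also have "\<dots> = of_real (2 * P1)"
        unfolding det P1_def by (simp add: complex_norm_square del: of_real_power)
      finally show ?thesis by (simp only: of_real_mult of_real_numeral mult_cancel_left) simp
    qed
    have S1: "y * q + cnj x * s = of_real S1"
    proof -
      have "2 * (y * q + cnj x * s) = q * cnj q + s * cnj s + (p * s - q * r)"
        by (simp add: x_def y_def field_simps)
      also have "\<dots> = of_real (2 * S1)"
        unfolding det S1_def by (simp add: complex_norm_square del: of_real_power)
      finally show ?thesis by (simp only: of_real_mult of_real_numeral mult_cancel_left) simp
    qed
    have k': "y * p + cnj x * r = cnj k"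
      by (simp add: k_def x_def y_def field_simps)
    have sum: "P1 + S1 > 0"
    proof -
      have "(cmod p)\<^sup>2 + (cmod q)\<^sup>2 + (cmod r)\<^sup>2 + (cmod s)\<^sup>2 > 0"
        using nz by (auto simp: add_pos_nonneg add_nonneg_pos)
      then show ?thesis using det(2) by (simp add: P1_def S1_def field_simps)
    qed
    have xy: "(x, y) \<noteq> (0, 0)"
    proof
      assume "(x, y) = (0, 0)"
      then have "P1 = 0" "S1 = 0" using P1 S1 by simp_all
      then show False using sum by simp
    qed
    have "complex_of_real (P1 * S1 - (cmod k)\<^sup>2) = of_real (((cmod x)\<^sup>2 + (cmod y)\<^sup>2) * \<delta>)"
      unfolding of_real_diff of_real_mult of_real_add complex_norm_square P1[symmetric] S1[symmetric]
        k'[symmetric] det(1)[symmetric] unfolding k_def by algebra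
    then have "P1 * S1 - (cmod k)\<^sup>2 = ((cmod x)\<^sup>2 + (cmod y)\<^sup>2) * \<delta>" by (simp only: of_real_eq_iff)
    then have "(cmod k)\<^sup>2 \<le> P1 * S1" using det(2) by (metis diff_ge_0_iff_ge add_nonneg_nonneg mult_nonneg_nonneg zero_le_power2)
    moreover have "((P1 - S1) / 2)\<^sup>2 + P1 * S1 = ((P1 + S1) / 2)\<^sup>2"
      by (simp add: power2_eq_square field_simps)
    ultimately have "((P1 - S1) / 2)\<^sup>2 + (cmod k)\<^sup>2 \<le> ((P1 + S1) / 2)\<^sup>2" by linarith
    then have "classified (biherm a' (of_real ((P1 + S1) / 2 + (P1 - S1) / 2)) k (cnj k)
        (of_real ((P1 + S1) / 2 - (P1 - S1) / 2)) 0)" for a'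
      using sum by (rule_tac classified_bottom_zero_hermitian) simp_all
    moreover have "(P1 + S1) / 2 + (P1 - S1) / 2 = P1" "(P1 + S1) / 2 - (P1 - S1) / 2 = S1"
      by (simp_all add: field_simps)
    ultimately have fin: "classified (biherm a' (of_real P1) k (cnj k) (of_real S1) 0)" for a'
      by (simp only:)
    show ?thesis
    proof (rule classified_diag[OF xy])
      show "(1 :: complex, 0 :: complex) \<noteq> (0, 0)" by simp
    qed (use fin in \<open>simp only: P1 S1 k' k_def[symmetric] complex_cnj_one complex_cnj_zero mult_1_right
          mult_zero_right diff_0_right add_0_left\<close>)
  qed
  show ?thesis
  proof (cases "(p, q, r, s) = (0, 0, 0, 0)")
    case True
    then have "a \<noteq> 0" using assms by (simp add: biherm_zero_iff)
    moreover have "classified (biherm 1 0 0 0 0 0)"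
      using classified_rep_mat[of RealNull] by (simp add: orbit_types_def)
    ultimately show ?thesis using True by (rule_tac classified_cscale[of "1 / a"]) simp_all
  next
    case False
    show ?thesis
    proof (cases "p * s - q * r = 0")
      case True
      then show ?thesis using real_det[of p s q r 0] False by simp
    next
      case d: False
      define c where "c = 1 / csqrt (p * s - q * r)"
      have c: "c \<noteq> 0" using d by (simp add: c_def)
      have "c * p * (c * s) - c * q * (c * r) = c\<^sup>2 * (p * s - q * r)"
        by (simp add: power2_eq_square algebra_simps)
      also have "\<dots> = of_real 1" using d by (simp add: c_def power_divide)
      finally have "classified (biherm (c * a) (c * p) (c * q) (c * r) (c * s) 0)"
        using real_det[of "c * p" "c * s" "c * q" "c * r" 1 "c * a"] False c by simp
      then show ?thesis using c by (rule_tac classified_cscale[of c]) simp_all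
    qed
  qed
qed

text \<open>The point is a combination of two real null vectors with coefficients \<open>1\<close> and \<open>b\<close>.  Scaling leaves only
the phase of \<open>b\<close>, and the swap inverts it, which brings the argument into \<open>[0, \<pi>]\<close>.\<close>

lemma classified_diagonal:
  assumes "b \<noteq> 0"
  shows "classified (biherm 1 0 0 0 0 b)"
proof -
  have unit: "classified (biherm 1 0 0 0 0 (exp (\<i> * of_real \<theta>)))" if \<theta>: "0 \<le> \<theta>" "\<theta> \<le> pi" for \<theta>
  proof -
    consider "\<theta> = 0" | "0 < \<theta>" "\<theta> < pi" | "\<theta> = pi" using \<theta> by linarith
    then show ?thesis
    proof cases
      case 1
      then show ?thesis using classified_rep_mat[of RealTimelike] by (simp add: orbit_types_def)
    next
      case 2
      then show ?thesis using classified_rep_mat[of "NonrealLorentzian \<theta>"] by (simp add: orbit_types_def)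
    next
      case 3
      have "classified (biherm (-1) 0 0 0 0 1)"
        using classified_rep_mat[of RealSpacelike] by (simp add: orbit_types_def)
      then have "classified (biherm 1 0 0 0 0 (-1))" by (rule_tac classified_cscale[of "-1"]) simp_all
      then show ?thesis by (simp add: 3 exp_pi_i')
    qed
  qed
  define \<theta> where "\<theta> = Arg b"
  have \<theta>: "- pi < \<theta>" "\<theta> \<le> pi" using Arg_bounded[of b] by (simp_all add: \<theta>_def)
  have "classified (biherm 1 0 0 0 0 (exp (\<i> * of_real \<theta>)))"
  proof (cases "0 \<le> \<theta>")
    case True
    then show ?thesis using unit \<theta> by simp
  next
    case False
    then have "classified (biherm 1 0 0 0 0 (exp (\<i> * of_real (- \<theta>))))"
      using unit[of "- \<theta>"] \<theta> by simp
    then have "classified (biherm (exp (\<i> * of_real \<theta>)) 0 0 0 0 1)"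
      by (rule_tac classified_cscale[of "exp (\<i> * of_real (- \<theta>))"]) (simp_all flip: exp_add)
    then show ?thesis by (rule_tac classified_swap) simp
  qed
  moreover have "of_real ((1 / sqrt (cmod b))\<^sup>2) * b = exp (\<i> * of_real \<theta>)"
  proof -
    define r where "r = cmod b"
    have r: "r > 0" "b = of_real r * exp (\<i> * of_real \<theta>)"
      using Arg_eq[OF assms] assms by (simp_all add: \<theta>_def r_def)
    have "(1 / sqrt r)\<^sup>2 = 1 / r" using r(1) by (simp add: power_divide)
    then show ?thesis unfolding r_def[symmetric] using r by simp
  qed
  ultimately show ?thesis
    using assms by (rule_tac classified_scale[of 1 "1 / sqrt (cmod b)"]) (simp_all del: of_real_power)
qed

lemma classified_diagonal_entries:
  assumes "a \<noteq> 0"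
  shows "classified (biherm a 0 0 0 0 b)"
proof (cases "b = 0")
  case True
  then show ?thesis using assms classified_bottom_zero by (simp add: biherm_zero_iff)
next
  case False
  then have "classified (biherm 1 0 0 0 0 (b / a))" using assms by (rule_tac classified_diagonal) simp
  then show ?thesis using assms by (rule_tac classified_cscale[of "1 / a"]) simp_all
qed

text \<open>Adding a suitable real multiple of the first coordinate to the second makes \<open>b\<close> equal to a real number
\<open>\<beta>\<close>.  If \<open>\<beta> \<le> 0\<close>, a further unipotent by a multiple of the quaternion \<open>j\<close>, orthogonal to \<open>P\<close>, adds
\<open>-\<beta>\<close> and reaches \<open>b = 0\<close>.  If \<open>\<beta> > 0\<close>, scaling makes the two diagonal entries equal and the Hadamard
transformation then diagonalises; here \<open>p\<close> is not real, so the diagonal entry \<open>2 + 2 p\<close> does not vanish.\<close>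

lemma classified_imaginary_scalar: "classified (biherm 1 \<i> 0 0 \<i> b)"
proof -
  define c where "c = - Im b / 2"
  define \<beta> where "\<beta> = Re b + c\<^sup>2"
  define p where "p = \<i> + of_real c"
  have "classified (biherm 1 p 0 0 p (of_real \<beta>))"
  proof (cases "\<beta> \<le> 0")
    case True
    define w where "w = complex_of_real (sqrt (- \<beta>))"
    have w: "cnj w = w" "w * w = - of_real \<beta>"
      using True by (simp_all add: w_def flip: of_real_mult of_real_minus)
    have "classified (biherm 1 p w (- w) p 0)" by (rule classified_bottom_zero) (simp add: biherm_zero_iff)
    then show ?thesis by (rule_tac classified_lower[where z = 0 and w = w]) (simp add: w)
  next
    case False
    define v where "v = 1 / sqrt \<beta>"
    have v: "v \<noteq> 0" "v\<^sup>2 * \<beta> = 1" using False by (simp_all add: v_def power_divide)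
    define p' where "p' = of_real v * p"
    have "Im p' = v" by (simp add: p'_def p_def)
    then have "2 + 2 * p' \<noteq> 0" using v(1) by (auto simp: complex_eq_iff)
    then have "classified (biherm (2 + 2 * p') 0 0 0 0 (2 - 2 * p'))" by (rule classified_diagonal_entries)
    then have "classified (biherm 1 p' 0 0 p' 1)"
      by (rule_tac classified_act[OF hadamard_move(1)]) (simp add: hadamard_move(2))
    moreover have "of_real (v\<^sup>2) * of_real \<beta> = (1 :: complex)" unfolding of_real_mult[symmetric] v(2) by simp
    ultimately show ?thesis using v(1)
      by (rule_tac classified_scale[of 1 v]) (simp_all add: p'_def del: of_real_power)
  qed
  moreover have "b + of_real c * \<i> + of_real c * \<i> + of_real c * of_real c = of_real \<beta>"
    by (simp add: complex_eq_iff \<beta>_def c_def power2_eq_square)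
  ultimately show ?thesis
    by (rule_tac classified_lower[where z = "of_real c" and w = 0]) (simp add: p_def)
qed

text \<open>Completing the square removes the real part of \<open>P\<close>.  The imaginary part is \<open>\<i>\<close> times a quaternion; if that
quaternion is nonzero, multiplying by its conjugate makes it a positive scalar.\<close>

lemma classified_top_one: "classified (biherm 1 p q r s b)"
proof -
  define m n where "m = (p - cnj s) / 2" and "n = (q + cnj r) / 2"
  have imag: "classified (biherm 1 m n (cnj n) (- cnj m) b')" for b'
  proof (cases "(m, n) = (0, 0)")
    case True
    then show ?thesis using classified_diagonal_entries[of 1 b'] by simp
  next
    case False
    define u where "u = m * cnj m + n * cnj n"
    have "u = of_real ((cmod m)\<^sup>2 + (cmod n)\<^sup>2)" by (simp only: u_def of_real_add complex_norm_square)
    moreover have "(cmod m)\<^sup>2 + (cmod n)\<^sup>2 \<noteq> 0" using False by (simp add: sum_power2_eq_zero_iff)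
    ultimately have u: "u \<noteq> 0" by (simp only: of_real_eq_0_iff not_False_eq_True)
    \<comment> \<open>\<open>u\<close> is the square norm of that quaternion.\<close>
    have "classified (biherm 1 \<i> 0 0 \<i> (b' / u))" by (rule classified_imaginary_scalar)
    then have "classified (biherm u (\<i> * u) 0 0 (\<i> * u) b')"
      using u by (rule_tac classified_cscale[of "1 / u"]) simp_all
    then show ?thesis
      using False by (rule_tac classified_diag[of "\<i> * cnj m" "\<i> * cnj n" 1 0]) (simp_all add: u_def algebra_simps)
  qed
  define z w where "z = - (cnj p + s) / 2" and "w = (r - cnj q) / 2"
  have "p + cnj z = m" "q + cnj w = n" "r - w = cnj n" "s + z = - cnj m"
    by (simp_all add: z_def w_def m_def n_def field_simps)
  then show ?thesis using imag by (rule_tac classified_lower[where z = z and w = w]) simp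
qed

lemma classified_nonzero:
  assumes "M \<in> ext2" "M \<noteq> 0"
  shows "classified M"
proof -
  obtain a p q r s b where M: "M = biherm a p q r s b" using ext2_biherm[OF assms(1)] by blast
  have a: "classified (biherm a p q r s b)" if "a \<noteq> 0" for a p q r s b
    using that classified_top_one by (rule_tac classified_cscale[of "1 / a"]) simp_all
  consider "a \<noteq> 0" | "b \<noteq> 0" | "b = 0" by blast
  then show ?thesis
  proof cases
    case 1
    then show ?thesis unfolding M by (rule a)
  next
    case 2
    then show ?thesis unfolding M by (rule_tac classified_swap) (rule a)
  next
    case 3
    then show ?thesis using assms(2) classified_bottom_zero unfolding M by blast
  qed
qed

section \<open>Separation of the list\<close>

lemma rep_mat_invariants:
  "ratio (rep_mat RealTimelike) = 2" "ratio (rep_mat RealSpacelike) = - 2"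
  "ratio (rep_mat NonrealDegenerate) = - 2"
  "ratio (rep_mat (NonrealLorentzian \<theta>)) = 2 * cos \<theta>"
  "0 < l \<Longrightarrow> l < 1 \<Longrightarrow> ratio (rep_mat (NonrealNegdef l)) = - 2 * (1 + l\<^sup>2) / (1 - l\<^sup>2)"
  "pfaffian (rep_mat RealNull) = 0" "pfaffian (rep_mat NonrealIsotropic) = 0"
  "hform (rep_mat RealNull) = 0" "hform (rep_mat NonrealIsotropic) \<noteq> 0"
  "pfaffian (rep_mat RealTimelike) \<noteq> 0" "pfaffian (rep_mat RealSpacelike) \<noteq> 0"
  "pfaffian (rep_mat NonrealDegenerate) \<noteq> 0" "pfaffian (rep_mat (NonrealLorentzian \<theta>)) \<noteq> 0"
  "0 < l \<Longrightarrow> l < 1 \<Longrightarrow> pfaffian (rep_mat (NonrealNegdef l)) \<noteq> 0"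
  "real_point (rep_mat RealSpacelike)" "\<not> real_point (rep_mat NonrealDegenerate)"
proof -
  have l: "pfaffian (rep_mat (NonrealNegdef l)) = - of_real (1 - l\<^sup>2)" "0 < 1 - l\<^sup>2" if "0 < l" "l < 1" for l
    using that by (simp_all add: pfaffian_biherm abs_square_less_1 algebra_simps) (simp_all add: power2_eq_square algebra_simps)
  show "ratio (rep_mat (NonrealNegdef l)) = - 2 * (1 + l\<^sup>2) / (1 - l\<^sup>2)" if "0 < l" "l < 1"
  proof -
    have "cmod (- of_real (1 - l\<^sup>2)) = 1 - l\<^sup>2" using l(2)[OF that] unfolding norm_minus_cancel norm_of_real by simp
    then show ?thesis unfolding ratio_def l(1)[OF that] using that
      by (simp add: hform_biherm norm_mult)
  qed
  show "pfaffian (rep_mat (NonrealNegdef l)) \<noteq> 0" if "0 < l" "l < 1"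
    unfolding l(1)[OF that] neg_equal_0_iff_equal of_real_eq_0_iff using l(2)[OF that] by simp
qed (simp_all add: ratio_def hform_biherm pfaffian_biherm real_point_biherm Re_exp norm_exp_eq_Re)

lemma Lorentzian_ratio:
  assumes "NonrealLorentzian \<theta> \<in> orbit_types"
  shows "- 2 < ratio (rep_mat (NonrealLorentzian \<theta>))" "ratio (rep_mat (NonrealLorentzian \<theta>)) < 2"
proof -
  have "0 < \<theta>" "\<theta> < pi" using assms by (auto simp: orbit_types_def)
  then have "- 1 < cos \<theta>" "cos \<theta> < 1" using cos_monotone_0_pi[of 0 \<theta>] cos_monotone_0_pi[of \<theta> pi] by simp_all
  then show "- 2 < ratio (rep_mat (NonrealLorentzian \<theta>))" "ratio (rep_mat (NonrealLorentzian \<theta>)) < 2"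
    unfolding rep_mat_invariants by simp_all
qed

text \<open>The second equation inverts \<open>l \<mapsto> -2 (1 + l\<^sup>2) / (1 - l\<^sup>2)\<close>, so that the ratio determines \<open>l\<close>.\<close>

lemma Negdef_ratio:
  assumes "NonrealNegdef l \<in> orbit_types"
  shows "ratio (rep_mat (NonrealNegdef l)) < - 2"
    and "l\<^sup>2 = (- 2 - ratio (rep_mat (NonrealNegdef l))) / (2 - ratio (rep_mat (NonrealNegdef l)))"
    and "pfaffian (rep_mat (NonrealNegdef l)) \<noteq> 0"
proof -
  have l: "0 < l" "l < 1" using assms by (auto simp: orbit_types_def)
  then have "l\<^sup>2 < 1" "0 < l\<^sup>2" by (simp_all add: abs_square_less_1)
  then show "ratio (rep_mat (NonrealNegdef l)) < - 2"
    "l\<^sup>2 = (- 2 - ratio (rep_mat (NonrealNegdef l))) / (2 - ratio (rep_mat (NonrealNegdef l)))"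
    unfolding rep_mat_invariants(5)[OF l] by (simp_all add: field_simps)
  show "pfaffian (rep_mat (NonrealNegdef l)) \<noteq> 0" using l by (rule rep_mat_invariants(14))
qed

text \<open>The Pfaffian vanishes exactly on \<open>RealNull\<close> and \<open>NonrealIsotropic\<close>, which \<open>hform\<close> tells apart.  On the
other points the ratio is \<open>2\<close> for \<open>RealTimelike\<close>, \<open>-2\<close> for \<open>RealSpacelike\<close> and \<open>NonrealDegenerate\<close>,
strictly between for \<open>NonrealLorentzian\<close>, and less than \<open>-2\<close> for \<open>NonrealNegdef\<close>.  Reality separates
\<open>RealSpacelike\<close> from \<open>NonrealDegenerate\<close>.\<close>

lemma rep_mat_inj:
  assumes t: "t \<in> orbit_types" and t': "t' \<in> orbit_types" and eq: "rep_mat t \<approx>\<^sub>H rep_mat t'"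
    and eq': "rep_mat t' \<approx>\<^sub>H rep_mat t"
  shows "t = t'"
proof -
  note inv = invariants_equiv[OF eq rep_mat_in_ext2 rep_mat_in_ext2]
  have re: "real_point (rep_mat t) \<longleftrightarrow> real_point (rep_mat t')"
    using inv(4) invariants_equiv(4)[OF eq' rep_mat_in_ext2 rep_mat_in_ext2] by blast
  have lor: "ratio (rep_mat (NonrealLorentzian \<theta>)) \<noteq> 2" "ratio (rep_mat (NonrealLorentzian \<theta>)) \<noteq> - 2"
    if "NonrealLorentzian \<theta> \<in> orbit_types" for \<theta> using Lorentzian_ratio[OF that] by auto
  have neg: "ratio (rep_mat (NonrealNegdef l)) \<noteq> 2" "ratio (rep_mat (NonrealNegdef l)) \<noteq> - 2"
    if "NonrealNegdef l \<in> orbit_types" for l using Negdef_ratio(1)[OF that] by auto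
  have cross: "ratio (rep_mat (NonrealLorentzian \<theta>)) \<noteq> ratio (rep_mat (NonrealNegdef l))"
    "ratio (rep_mat (NonrealNegdef l)) \<noteq> ratio (rep_mat (NonrealLorentzian \<theta>))"
    if "NonrealLorentzian \<theta> \<in> orbit_types" "NonrealNegdef l \<in> orbit_types" for \<theta> l
    using Lorentzian_ratio[OF that(1)] Negdef_ratio(1)[OF that(2)] by auto
  have inj_lor: "ratio (rep_mat (NonrealLorentzian \<theta>)) = ratio (rep_mat (NonrealLorentzian \<theta>')) \<longleftrightarrow> \<theta> = \<theta>'"
    if "NonrealLorentzian \<theta> \<in> orbit_types" "NonrealLorentzian \<theta>' \<in> orbit_types" for \<theta> \<theta>'
  proof -
    have "0 \<le> \<theta>" "\<theta> \<le> pi" "0 \<le> \<theta>'" "\<theta>' \<le> pi" using that by (auto simp: orbit_types_def)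
    then show ?thesis using cos_inj_pi[of \<theta> \<theta>'] unfolding rep_mat_invariants by auto
  qed
  have inj_neg: "ratio (rep_mat (NonrealNegdef l)) = ratio (rep_mat (NonrealNegdef l')) \<longleftrightarrow> l = l'"
    if "NonrealNegdef l \<in> orbit_types" "NonrealNegdef l' \<in> orbit_types" for l l'
  proof
    assume "ratio (rep_mat (NonrealNegdef l)) = ratio (rep_mat (NonrealNegdef l'))"
    then have "l\<^sup>2 = l'\<^sup>2" unfolding Negdef_ratio(2)[OF that(1)] Negdef_ratio(2)[OF that(2)] by simp
    moreover have "0 \<le> l" "0 \<le> l'" using that by (auto simp: orbit_types_def)
    ultimately show "l = l'" by (simp add: power2_eq_iff_nonneg)
  qed simp
  note facts = rep_mat_invariants(1-3,6-13,15,16) Negdef_ratio(3) lor neg cross inj_lor inj_neg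
  show ?thesis
    using t t' inv(1-3) re
    by (cases t; cases t') (simp_all add: facts del: rep_mat.simps)
qed

section \<open>The classification\<close>

theorem theorem3p10:
  "(\<forall>orb \<in> orbits PGL2H proj_ext2 proj_act.
       \<exists>!t. t \<in> orbit_types \<and> orb = orbit PGL2H proj_act (representative t)) \<and>
   inj_on (\<lambda>t. orbit PGL2H proj_act (representative t)) orbit_types"
proof -
  let ?o = "\<lambda>t. orbit PGL2H proj_act (representative t)"
  have eq: "?o t = ?o t' \<longleftrightarrow> rep_mat t \<approx>\<^sub>H rep_mat t'" for t t'
    unfolding representative_rep_mat by (intro orbit_eq_iff rep_mat_in_ext2 rep_mat_nonzero)
  have inj: "inj_on ?o orbit_types"
  proof (rule inj_onI)
    fix t t' assume "t \<in> orbit_types" "t' \<in> orbit_types" "?o t = ?o t'"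
    then show "t = t'" using rep_mat_inj eq by metis
  qed
  moreover have "\<exists>t\<in>orbit_types. orb = ?o t" if orb: "orb \<in> orbits PGL2H proj_ext2 proj_act" for orb
  proof -
    obtain M where M: "M \<in> ext2" "M \<noteq> 0" "orb = orbit PGL2H proj_act (cline M)"
      using orb unfolding orbits_def proj_ext2_def by blast
    obtain t where "t \<in> orbit_types" "M \<approx>\<^sub>H rep_mat t"
      using classified_nonzero[OF M(1,2)] unfolding classified_def by blast
    then show ?thesis
      using orbit_eq_iff[OF M(1,2) rep_mat_in_ext2 rep_mat_nonzero] M(3)
      unfolding representative_rep_mat by blast
  qed
  ultimately show ?thesis by (metis (no_types, lifting) inj_onD)
qed

end
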